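(* If $T\ne K_2$ is a tree with $\ell\ge 2$ leaves, then no rational in $[0,\ell]\setminus\mathbb{Z}$ is realizable for $T$.
   Context: Graphs are finite and simple; $v(H)$ denotes the number of vertices of $H$. A leaf of a tree is a vertex of degree $1$. A graph is $\mathcal{F}$-free, for a family of graphs $\mathcal{F}$, if it contains no (not necessarily induced) subgraph isomorphic to a member of $\mathcal{F}$. $\mathrm{ex}(n,H,\mathcal{F})$ is the maximum number of copies of $H$ (subgraphs isomorphic to $H$) that an $n$-vertex $\mathcal{F}$-free graph can have, with the convention that it is $0$ if there is no $\mathcal{F}$-free graph on $n$ vertices. A rational number $r\in[0,v(H)]$ is realizable for $H$ if there exists a finite family of graphs $\mathcal{F}$ such that $\mathrm{ex}(n,H,\mathcal{F})=\Theta(n^r)$ as $n\to\infty$. *)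

theory Defs
  imports
    Complex_Main
    "HOL-Library.Landau_Symbols"
    "Graph_Theory.Digraph_Component"
    "Graph_Theory.Digraph_Isomorphism"
    "Graph_Theory.Kuratowski"
begin

text \<open>
  A finite simple graph is a \<^locale>\<open>pair_graph\<close>: a finite vertex set with a symmetric,
  irreflexive relation of arcs, so that every edge is represented by its two orientations.
  The function \<^const>\<open>with_proj\<close> equips it with the two projections as tail and head maps.
\<close>

text \<open>
  The constant \<^const>\<open>tree\<close> of the library is not usable here: in a symmetric digraph, an arc
  followed by its reversal is a \<^const>\<open>pre_digraph.cycle\<close> of length 2. The cycles of
  an undirected graph are exactly those of length at least 3.
\<close>

definition undirected_tree :: "'a pair_pre_digraph \<Rightarrow> bool" where
  "undirected_tree T \<longleftrightarrow> pair_graph T \<and> Digraph_Component.connected (with_proj T) \<and>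
     \<not> (\<exists>p. pre_digraph.cycle (with_proj T) p \<and> 3 \<le> length p)"

text \<open>In a symmetric digraph the out-degree is the degree of the underlying graph.\<close>

definition leaves :: "'a pair_pre_digraph \<Rightarrow> 'a set" where
  "leaves T = {v \<in> pverts T. out_degree (with_proj T) v = 1}"

definition copies :: "'a pair_pre_digraph \<Rightarrow> 'b pair_pre_digraph \<Rightarrow> 'b pair_pre_digraph set" where
  "copies H G = 
     {S. subgraph (with_proj S) (with_proj G) \<and> digraph_iso (with_proj H) (with_proj S)}"

text \<open>
  A subgraph in the sense of the library need not be symmetric, but one that is isomorphic to
  a graph is.
\<close>

lemma digraph_iso_pair_graph:
  fixes H :: "'a pair_pre_digraph" and S :: "'b pair_pre_digraph"
  assumes H: "pair_graph H" and iso: "digraph_iso (with_proj H) (with_proj S)"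
  shows "pair_graph S"
proof -
  interpret H: pair_graph H by (rule H)
  obtain f where f: "pre_digraph.digraph_isomorphism H f" "with_proj S = app_iso f H"
    using iso by (auto simp: digraph_iso_def)
  let ?g = "iso_verts f"
  have inj: "inj_on ?g (pverts H)"
    using f(1) by (simp add: H.digraph_isomorphism_def)
  have V: "pverts S = ?g ` pverts H"
    using arg_cong[OF f(2), of verts] by simp
  have t: "iso_tail f = fst" and h: "iso_head f = snd"
    using arg_cong[OF f(2), of tail] arg_cong[OF f(2), of head] by simp_all
  have arc: "iso_arcs f e = (?g (fst e), ?g (snd e))" if "e \<in> parcs H" for e
    using f(1) that unfolding H.digraph_isomorphism_def by (auto simp: t h prod_eq_iff)
  have "parcs S = iso_arcs f ` parcs H"
    using arg_cong[OF f(2), of arcs] by simp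
  also have "\<dots> = (\<lambda>e. (?g (fst e), ?g (snd e))) ` parcs H"
    using arc by (rule image_cong[OF refl])
  finally have A: "parcs S = (\<lambda>e. (?g (fst e), ?g (snd e))) ` parcs H" .
  show ?thesis
  proof
    show "finite (pverts S)" "finite (parcs S)"
      by (simp_all add: V A H.pair_finite_verts H.pair_finite_arcs)
    show "symmetric S"
    proof -
      have "(b, a) \<in> parcs H" if "(a, b) \<in> parcs H" for a b
        using H.pair_sym_arcs that by (simp add: symmetric_def sym_def)
      then have "sym (parcs S)"
        unfolding A sym_def by (auto simp: image_iff) (metis fst_conv snd_conv)
      then show ?thesis
        by (simp add: symmetric_def)
    qed
    fix e assume e: "e \<in> parcs S"
    then show "fst e \<in> pverts S" "snd e \<in> pverts S"
      by (auto simp: A V intro: H.in_arcsD1 H.in_arcsD2)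
    from e show "fst e \<noteq> snd e"
      using inj H.pair_no_loops by (auto simp: A) (metis H.in_arcsD1 H.in_arcsD2 fst_conv inj_onD snd_conv)
  qed
qed

definition family_free :: "'a pair_pre_digraph set \<Rightarrow> 'b pair_pre_digraph \<Rightarrow> bool" where
  "family_free \<F> G \<longleftrightarrow> (\<forall>F\<in>\<F>. copies F G = {})"

text \<open>
  Host graphs and forbidden graphs have natural numbers as vertices; every finite graph is
  isomorphic to such a graph.
\<close>

definition copy_counts ::
    "nat \<Rightarrow> 'a pair_pre_digraph \<Rightarrow> nat pair_pre_digraph set \<Rightarrow> nat set" where
  "copy_counts n H \<F> =
     {card (copies H G) | G :: nat pair_pre_digraph.
        pair_graph G \<and> card (pverts G) = n \<and> family_free \<F> G}"

definition ex_num :: "nat \<Rightarrow> 'a pair_pre_digraph \<Rightarrow> nat pair_pre_digraph set \<Rightarrow> nat" where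
  "ex_num n H \<F> = (if copy_counts n H \<F> = {} then 0 else Max (copy_counts n H \<F>))"

text \<open>The maximum is taken over a finite set, as required for \<^const>\<open>Max\<close> to be meaningful.\<close>

lemma card_copies_le:
  fixes G :: "'b pair_pre_digraph"
  assumes "pair_graph G"
  shows "finite (copies H G)" and "card (copies H G) \<le> 2 ^ (card (pverts G) + card (pverts G) ^ 2)"
proof -
  interpret pair_graph G by (rule assms)
  let ?P = "Pow (pverts G) \<times> Pow (pverts G \<times> pverts G)"
  have sub: "(\<lambda>S. (pverts S, parcs S)) ` copies H G \<subseteq> ?P"
  proof
    fix x assume "x \<in> (\<lambda>S. (pverts S, parcs S)) ` copies H G"
    then obtain S where "S \<in> copies H G" and S: "x = (pverts S, parcs S)"
      by (rule imageE)
    then have "pverts S \<subseteq> pverts G" "parcs S \<subseteq> parcs G"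
      by (simp_all add: copies_def subgraph_def)
    moreover
    have "parcs G \<subseteq> pverts G \<times> pverts G"
      using in_arcsD1 in_arcsD2 by auto
    ultimately show "x \<in> ?P" by (auto simp: S)
  qed
  have inj: "inj_on (\<lambda>S. (pverts S, parcs S)) (copies H G)"
    by (rule inj_onI) auto
  have fin: "finite ?P"
    by (simp add: pair_finite_verts)
  show "finite (copies H G)"
    using inj_on_finite[OF inj sub fin] .
  have "card (copies H G) \<le> card ?P"
    using card_inj_on_le[OF inj sub fin] .
  also have "\<dots> = 2 ^ (card (pverts G) + card (pverts G) ^ 2)"
    by (simp add: card_cartesian_product card_Pow pair_finite_verts power_add power2_eq_square)
  finally show "card (copies H G) \<le> 2 ^ (card (pverts G) + card (pverts G) ^ 2)" .
qed

lemma finite_copy_counts: "finite (copy_counts n H \<F>)"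
proof (rule finite_subset)
  show "copy_counts n H \<F> \<subseteq> {..2 ^ (n + n ^ 2)}"
    unfolding copy_counts_def using card_copies_le(2) by blast
qed simp

definition realizable :: "'a pair_pre_digraph \<Rightarrow> real \<Rightarrow> bool" where
  "realizable H r \<longleftrightarrow>
     r \<in> \<rat> \<and> 0 \<le> r \<and> r \<le> real (card (pverts H)) \<and>
     (\<exists>\<F> :: nat pair_pre_digraph set. finite \<F> \<and> (\<forall>F\<in>\<F>. pair_graph F) \<and>
        (\<lambda>n. real (ex_num n H \<F>)) \<in> \<Theta>(\<lambda>n. real n powr r))"

end

theory Submission
  imports Defs "Graph_Theory.Vertex_Walk"
begin

text \<open>
  Label the vertices of \<^term>\<open>T\<close> by \<open>0, \<dots>, q\<close> such that edges between different labels have an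
  endpoint of label 0, and replace each of the \<open>q\<close> nonempty classes of nonzero label by many disjoint
  copies. If all these blow-ups are \<open>\<F>\<close>-free, they contain of order \<open>n\<^sup>q\<close> copies of \<^term>\<open>T\<close>.

  Since \<open>r < l\<close>, some blow-up of the set of leaves contains a member of \<open>\<F>\<close>. It is a forest, so
  \<open>\<F>\<close>-free graphs have linearly many edges. In a host with at most \<open>d n\<close> edges, more than
  \<open>C n\<^sup>q\<^sup>-\<^sup>1\<close> copies of a forest force a large blow-up with \<open>q\<close> classes: remove a vertex \<open>v\<close> with a single
  neighbour \<open>w\<close>; either some image of \<open>w\<close> has many neighbours and lies in many copies, in which case
  \<open>w\<close> is fixed and \<open>v\<close> becomes a class of its own, or almost all copies of the smaller forest extend
  in boundedly many ways. Applied with \<open>q = \<lceil>r\<rceil>\<close>, this yields at least \<open>c n\<^sup>q\<close> copies in \<open>\<F>\<close>-free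
  graphs, so \<open>r \<ge> q\<close> and \<open>r\<close> is an integer.
\<close>

subsection \<open>Blow-ups of forests in sparse partite hosts\<close>

text \<open>For finite simple graphs this says that the graph is a forest. Quantifying over subsets
  makes it pass to subsets at once and supplies the vertex removed in each induction on
  forests.\<close>

definition one_degenerate :: "'a set \<Rightarrow> 'a rel \<Rightarrow> bool" where
  "one_degenerate V E \<longleftrightarrow> (\<forall>X\<subseteq>V. X \<noteq> {} \<longrightarrow> (\<exists>v\<in>X. card {u \<in> X. (v, u) \<in> E} \<le> 1))"

lemma one_degenerate_mono: "one_degenerate V E \<Longrightarrow> V' \<subseteq> V \<Longrightarrow> one_degenerate V' E"
  unfolding one_degenerate_def by blast

lemma one_degenerate_cases:
  assumes "finite V" "V \<noteq> {}" "one_degenerate V E"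
  obtains v where "v \<in> V" "\<And>u. u \<in> V \<Longrightarrow> (v, u) \<notin> E"
    | v w where "v \<in> V" "w \<in> V" "\<And>u. u \<in> V \<Longrightarrow> (v, u) \<in> E \<longleftrightarrow> u = w"
proof -
  obtain v where v: "v \<in> V" "card {u \<in> V. (v, u) \<in> E} \<le> 1"
    using assms(2,3) unfolding one_degenerate_def by blast
  show thesis
  proof (cases "{u \<in> V. (v, u) \<in> E} = {}")
    case True
    then show ?thesis using v(1) that(1)[of v] by blast
  next
    case False
    moreover have "finite {u \<in> V. (v, u) \<in> E}" using assms(1) by simp
    ultimately have "card {u \<in> V. (v, u) \<in> E} = 1"
      using v(2) by (metis One_nat_def card_gt_0_iff le_antisym Suc_leI)
    then obtain w where "{u \<in> V. (v, u) \<in> E} = {w}" by (auto simp: card_1_singleton_iff)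
    then show ?thesis using v(1) that(2)[of v w] by blast
  qed
qed

text \<open>The sets \<open>A v\<close> are the parts of a host, one for each vertex
  \<open>v\<close>. Injectivity is left to the disjointness of the parts. \<open>PiE\<close> makes
  the maps extensional, so that they can be counted.\<close>

definition homs :: "'a set \<Rightarrow> 'a rel \<Rightarrow> ('a \<Rightarrow> 'b set) \<Rightarrow> 'b rel \<Rightarrow> ('a \<Rightarrow> 'b) set" where
  "homs V E A R =
     {\<phi> \<in> Pi\<^sub>E V A. \<forall>u\<in>V. \<forall>v\<in>V. (u, v) \<in> E \<longrightarrow> (\<phi> u, \<phi> v) \<in> R}"

lemma finite_homs: "finite V \<Longrightarrow> (\<And>v. v \<in> V \<Longrightarrow> finite (A v)) \<Longrightarrow> finite (homs V E A R)"
  unfolding homs_def by (rule finite_subset[OF _ finite_PiE[of V A]]) auto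

text \<open>Label 0 marks what all copies share, the labels \<open>1..q\<close> the classes to be
  multiplied. Edges leave a class only towards the shared part, so copies of different classes can
  be combined freely.\<close>

definition labelling :: "nat \<Rightarrow> 'a set \<Rightarrow> 'a rel \<Rightarrow> ('a \<Rightarrow> nat) \<Rightarrow> bool" where
  "labelling q V E \<kappa> \<longleftrightarrow> (\<forall>v\<in>V. \<kappa> v \<le> q) \<and> {1..q} \<subseteq> \<kappa> ` V \<and>
     (\<forall>u\<in>V. \<forall>v\<in>V. (u, v) \<in> E \<longrightarrow> \<kappa> u = \<kappa> v \<or> \<kappa> u = 0 \<or> \<kappa> v = 0)"

text \<open>\<open>\<Phi> v j\<close> is the image of \<open>v\<close> in copy number
  \<open>j\<close>. Images of different vertices may coincide here; disjointness of the parts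
  \<open>A v\<close> separates them later.\<close>

definition blow_up_map ::
  "nat \<Rightarrow> 'a set \<Rightarrow> 'a rel \<Rightarrow> ('a \<Rightarrow> 'b set) \<Rightarrow> 'b rel \<Rightarrow> ('a \<Rightarrow> nat) \<Rightarrow> ('a \<Rightarrow> nat \<Rightarrow> 'b) \<Rightarrow> bool" where
  "blow_up_map t V E A R \<kappa> \<Phi> \<longleftrightarrow>
     (\<forall>v\<in>V. \<forall>j<t. \<Phi> v j \<in> A v) \<and>
     (\<forall>v\<in>V. \<forall>i<t. \<forall>j<t. \<kappa> v = 0 \<longrightarrow> \<Phi> v i = \<Phi> v j) \<and>
     (\<forall>v\<in>V. \<kappa> v \<noteq> 0 \<longrightarrow> inj_on (\<Phi> v) {..<t}) \<and>
     (\<forall>u\<in>V. \<forall>v\<in>V. \<forall>j<t. (u, v) \<in> E \<longrightarrow> (\<Phi> u j, \<Phi> v j) \<in> R)"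

lemma blow_up_mapD:
  assumes "blow_up_map t V E A R \<kappa> \<Phi>" "v \<in> V"
  shows "j < t \<Longrightarrow> \<Phi> v j \<in> A v"
    and "\<kappa> v = 0 \<Longrightarrow> i < t \<Longrightarrow> j < t \<Longrightarrow> \<Phi> v i = \<Phi> v j"
    and "\<kappa> v \<noteq> 0 \<Longrightarrow> inj_on (\<Phi> v) {..<t}"
    and "u \<in> V \<Longrightarrow> j < t \<Longrightarrow> (u, v) \<in> E \<Longrightarrow> (\<Phi> u j, \<Phi> v j) \<in> R"
  using assms unfolding blow_up_map_def by blast+

lemma blow_up_mapI:
  assumes "\<And>v j. v \<in> V \<Longrightarrow> j < t \<Longrightarrow> \<Phi> v j \<in> A v"
    and "\<And>v i j. v \<in> V \<Longrightarrow> \<kappa> v = 0 \<Longrightarrow> i < t \<Longrightarrow> j < t \<Longrightarrow> \<Phi> v i = \<Phi> v j"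
    and "\<And>v. v \<in> V \<Longrightarrow> \<kappa> v \<noteq> 0 \<Longrightarrow> inj_on (\<Phi> v) {..<t}"
    and "\<And>u v j. u \<in> V \<Longrightarrow> v \<in> V \<Longrightarrow> j < t \<Longrightarrow> (u, v) \<in> E \<Longrightarrow> (\<Phi> u j, \<Phi> v j) \<in> R"
  shows "blow_up_map t V E A R \<kappa> \<Phi>"
  using assms unfolding blow_up_map_def by blast

text \<open>Either \<open>y\<close> takes at least \<open>t\<close> values on the
  \<open>t * t\<close> indices, or it takes fewer and some value is attained at least
  \<open>t\<close> times. \<open>g\<close> enumerates \<open>t\<close> suitable indices.\<close>

lemma pigeonhole_square:
  fixes y :: "nat \<Rightarrow> 'b" and t :: nat
  assumes "0 < t"
  obtains g where "inj_on g {..<t}" "g ` {..<t} \<subseteq> {..<t * t}"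
    "inj_on (\<lambda>j. y (g j)) {..<t} \<or> (\<exists>c. \<forall>j<t. y (g j) = c)"
proof -
  note result = that
  have *: thesis if J: "finite J" "t \<le> card J" "J \<subseteq> {..<t * t}" "inj_on y J \<or> (\<exists>c. \<forall>j\<in>J. y j = c)" for J
  proof -
    obtain h where h: "bij_betw h {0..<card J} J"
      using ex_bij_betw_nat_finite[OF J(1)] by blast
    have sub: "{..<t} \<subseteq> {0..<card J}" using J(2) by auto
    have inj: "inj_on h {..<t}" using h sub by (meson bij_betw_def inj_on_subset)
    have im: "h ` {..<t} \<subseteq> J" using h sub by (metis bij_betw_def image_mono)
    show thesis
    proof (rule result[OF inj])
      show "h ` {..<t} \<subseteq> {..<t * t}" using im J(3) by blast
      show "inj_on (\<lambda>j. y (h j)) {..<t} \<or> (\<exists>c. \<forall>j<t. y (h j) = c)"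
        using J(4)
      proof
        assume "inj_on y J"
        then have "inj_on (y \<circ> h) {..<t}" using inj im by (meson comp_inj_on inj_on_subset)
        then show ?thesis by (simp add: o_def)
      next
        assume "\<exists>c. \<forall>j\<in>J. y j = c"
        then have "\<exists>c. \<forall>j<t. y (h j) = c" using im
          by (meson image_subset_iff lessThan_iff)
        then show ?thesis ..
      qed
    qed
  qed
  show thesis
  proof (cases "t \<le> card (y ` {..<t * t})")
    case True
    obtain J where J: "J \<subseteq> {..<t * t}" "inj_on y J" "y ` {..<t * t} = y ` J"
      using subset_image_inj[of "y ` {..<t * t}" y "{..<t * t}"] by auto
    have "finite J" using J(1) finite_subset by blast
    moreover have "t \<le> card J" using True J by (metis card_image)
    ultimately show thesis using * J by blast
  next
    case False
    have "\<exists>c\<in>y ` {..<t * t}. card {..<t * t} \<le> card (y -` {c} \<inter> {..<t * t}) * card (y ` {..<t * t})"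
      using assms by (intro pigeonhole_card) (auto simp: lessThan_empty_iff)
    then obtain c where c: "t * t \<le> card (y -` {c} \<inter> {..<t * t}) * card (y ` {..<t * t})"
      by auto
    also have "\<dots> \<le> card (y -` {c} \<inter> {..<t * t}) * t" using False by simp
    finally have "t \<le> card (y -` {c} \<inter> {..<t * t})" using assms by simp
    then show thesis by (intro *[of "y -` {c} \<inter> {..<t * t}"]) auto
  qed
qed

lemma blow_up_map_reindex:
  assumes "blow_up_map t V E A R \<kappa> \<Phi>" "inj_on g {..<s}" "g ` {..<s} \<subseteq> {..<t}"
  shows "blow_up_map s V E A R \<kappa> (\<lambda>v j. \<Phi> v (g j))"
proof (rule blow_up_mapI)
  note D = blow_up_mapD[OF assms(1)]
  have g: "g j < t" if "j < s" for j using assms(3) that by auto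
  show "inj_on (\<lambda>j. \<Phi> v (g j)) {..<s}" if "v \<in> V" "\<kappa> v \<noteq> 0" for v
    using comp_inj_on[OF assms(2) inj_on_subset[OF D(3)[OF that] assms(3)]] by (simp add: o_def)
  show "\<Phi> v (g i) = \<Phi> v (g j)" if "v \<in> V" "\<kappa> v = 0" "i < s" "j < s" for v i j
    using D(2)[of v "g i" "g j"] g that by blast
next
  show "\<Phi> v (g j) \<in> A v" if "v \<in> V" "j < s" for v j
    using blow_up_mapD(1)[OF assms(1), of v "g j"] assms(3) that by blast
  show "(\<Phi> u (g j), \<Phi> v (g j)) \<in> R" if "u \<in> V" "v \<in> V" "j < s" "(u, v) \<in> E" for u v j
    using blow_up_mapD(4)[OF assms(1), of v u "g j"] assms(3) that by blast
qed

lemma labellingD: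
  assumes "labelling q V E \<kappa>"
  shows "v \<in> V \<Longrightarrow> \<kappa> v \<le> q"
    and "{1..q} \<subseteq> \<kappa> ` V"
    and "u \<in> V \<Longrightarrow> v \<in> V \<Longrightarrow> (u, v) \<in> E \<Longrightarrow> \<kappa> u = \<kappa> v \<or> \<kappa> u = 0 \<or> \<kappa> v = 0"
  using assms unfolding labelling_def by simp_all

lemma labellingI:
  assumes "\<And>v. v \<in> V \<Longrightarrow> \<kappa> v \<le> q" "{1..q} \<subseteq> \<kappa> ` V"
    "\<And>u v. u \<in> V \<Longrightarrow> v \<in> V \<Longrightarrow> (u, v) \<in> E \<Longrightarrow> \<kappa> u = \<kappa> v \<or> \<kappa> u = 0 \<or> \<kappa> v = 0"
  shows "labelling q V E \<kappa>"
  unfolding labelling_def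
proof (intro conjI ballI impI)
  show "{1..q} \<subseteq> \<kappa> ` V" by (fact assms(2))
qed (use assms(1,3) in \<open>simp_all\<close>)

text \<open>The condition \<open>{1..q} \<subseteq> insert k {1..p}\<close> covers two uses:
  \<open>q = p\<close> with a label \<open>k\<close> already available, and \<open>q = Suc p\<close>
  with the new label \<open>k = Suc p\<close>.\<close>

lemma labelling_extend:
  assumes "labelling p V E \<kappa>" "sym E" "irrefl E" "v \<notin> V" "p \<le> q" "k \<le> q"
    "{1..q} \<subseteq> insert k {1..p}"
    and nbr: "\<And>u. u \<in> V \<Longrightarrow> (v, u) \<in> E \<Longrightarrow> k = \<kappa> u \<or> k = 0 \<or> \<kappa> u = 0"
  shows "labelling q (insert v V) E (\<kappa>(v := k))"
proof -
  note \<kappa> = labellingD[OF assms(1)]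
  let ?\<kappa> = "\<kappa>(v := k)"
  have im: "?\<kappa> ` insert v V = insert k (\<kappa> ` V)" using assms(4) by auto
  have "{1..q} \<subseteq> ?\<kappa> ` insert v V"
    unfolding im using assms(7) \<kappa>(2) by (meson insert_mono order_trans)
  moreover have "?\<kappa> x = ?\<kappa> y \<or> ?\<kappa> x = 0 \<or> ?\<kappa> y = 0"
    if xy: "x \<in> insert v V" "y \<in> insert v V" "(x, y) \<in> E" for x y
  proof -
    have yx: "(y, x) \<in> E" using xy(3) assms(2) by (meson symD)
    have "x \<noteq> y" using xy(3) assms(3) by (auto simp: irrefl_def)
    then consider "x = v" "y \<in> V" "y \<noteq> v" | "y = v" "x \<in> V" "x \<noteq> v"
      | "x \<in> V" "y \<in> V" "x \<noteq> v" "y \<noteq> v"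
      using xy by blast
    then show ?thesis
    proof cases
      case 1 then show ?thesis using nbr[of y] xy(3) by simp
    next
      case 2 then show ?thesis using nbr[of x] yx by auto
    next
      case 3 then show ?thesis using \<kappa>(3)[OF _ _ xy(3)] by simp
    qed
  qed
  moreover have "?\<kappa> u \<le> q" if "u \<in> insert v V" for u
    using \<kappa>(1)[of u] assms(5,6) that order_trans[of "\<kappa> u" p q] by (cases "u = v") auto
  ultimately show ?thesis by (intro labellingI)
qed

text \<open>The parts may grow from \<open>A\<close> to \<open>B\<close> because the inductive steps
  find a blow-up inside restricted parts and place \<open>v\<close> afterwards in the original
  ones.\<close>

lemma blow_up_map_extend:
  assumes \<Phi>: "blow_up_map t V E A R \<kappa> \<Phi>" and "sym E" "irrefl E" "sym R" "v \<notin> V"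
    and sub: "\<And>u. u \<in> V \<Longrightarrow> A u \<subseteq> B u"
    and y: "\<And>j. j < t \<Longrightarrow> y j \<in> B v"
      "k = 0 \<and> (\<exists>c. \<forall>j<t. y j = c) \<or> k \<noteq> 0 \<and> inj_on y {..<t}"
      "\<And>u j. u \<in> V \<Longrightarrow> j < t \<Longrightarrow> (v, u) \<in> E \<Longrightarrow> (\<Phi> u j, y j) \<in> R"
  shows "blow_up_map t (insert v V) E B R (\<kappa>(v := k)) (\<Phi>(v := y))"
proof (rule blow_up_mapI)
  note D = blow_up_mapD[OF \<Phi>]
  fix a b j assume ab: "a \<in> insert v V" "b \<in> insert v V" "j < t" "(a, b) \<in> E"
  then have "a \<noteq> b" using assms(3) by (auto simp: irrefl_def)
  moreover have "(y j, \<Phi> b j) \<in> R" if "a = v"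
    using y(3)[of b j] ab that \<open>a \<noteq> b\<close> symD[OF assms(4)] by blast
  moreover have "(\<Phi> a j, y j) \<in> R" if "b = v"
    using y(3)[of a j] ab that \<open>a \<noteq> b\<close> symD[OF assms(2)] by blast
  ultimately show "((\<Phi>(v := y)) a j, (\<Phi>(v := y)) b j) \<in> R"
    using ab D(4)[of b a j] by auto
next
  fix a i j assume "a \<in> insert v V" "(\<kappa>(v := k)) a = 0" "i < t" "j < t"
  then show "(\<Phi>(v := y)) a i = (\<Phi>(v := y)) a j"
    using y(2) blow_up_mapD(2)[OF \<Phi>, of a i j] by (auto split: if_splits)
next
  fix a assume "a \<in> insert v V" "(\<kappa>(v := k)) a \<noteq> 0"
  then show "inj_on ((\<Phi>(v := y)) a) {..<t}"
    using y(2) blow_up_mapD(3)[OF \<Phi>, of a] by (auto split: if_splits)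
next
  fix a j assume "a \<in> insert v V" "j < t"
  then show "(\<Phi>(v := y)) a j \<in> B a"
    using y(1) sub blow_up_mapD(1)[OF \<Phi>, of a j] by auto
qed

section \<open>Extending a blow-up by one vertex\<close>

definition contains_blow_up ::
  "nat \<Rightarrow> nat \<Rightarrow> 'a set \<Rightarrow> 'a rel \<Rightarrow> ('a \<Rightarrow> 'b set) \<Rightarrow> 'b rel \<Rightarrow> bool" where
  "contains_blow_up q t V E A R \<longleftrightarrow>
     (\<exists>\<kappa> \<Phi>. labelling q V E \<kappa> \<and> blow_up_map t V E A R \<kappa> \<Phi>)"

lemma homs_remove:
  assumes "\<phi> \<in> homs V E A R"
  shows "restrict \<phi> (V - X) \<in> homs (V - X) E A R"
  using assms unfolding homs_def by auto

lemma contains_blow_up_0: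
  assumes "\<phi> \<in> homs V E A R"
  shows "contains_blow_up 0 t V E A R"
proof -
  have "labelling 0 V E (\<lambda>_. 0)" by (simp add: labelling_def)
  moreover have "blow_up_map t V E A R (\<lambda>_. 0) (\<lambda>v _. \<phi> v)"
    using assms by (intro blow_up_mapI) (auto simp: homs_def)
  ultimately show ?thesis unfolding contains_blow_up_def by blast
qed

text \<open>The vertex gets label 0 and the constant image \<open>x\<close>. The last hypothesis
  holds once the parts of the neighbours of \<open>v\<close> have been cut down to neighbours of
  \<open>x\<close>.\<close>

lemma blow_up_add_fixed:
  assumes "contains_blow_up q t V E A R" "sym E" "irrefl E" "sym R" "v \<notin> V"
    and "\<And>u. u \<in> V \<Longrightarrow> A u \<subseteq> B u" "x \<in> B v"
    and "\<And>u z. u \<in> V \<Longrightarrow> (v, u) \<in> E \<Longrightarrow> z \<in> A u \<Longrightarrow> (z, x) \<in> R"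
  shows "contains_blow_up q t (insert v V) E B R"
proof -
  obtain \<kappa> \<Phi> where *: "labelling q V E \<kappa>" "blow_up_map t V E A R \<kappa> \<Phi>"
    using assms(1) unfolding contains_blow_up_def by blast
  have "labelling q (insert v V) E (\<kappa>(v := 0))"
    using * assms by (intro labelling_extend[of q]) auto
  moreover have "blow_up_map t (insert v V) E B R (\<kappa>(v := 0)) (\<Phi>(v := (\<lambda>_. x)))"
    using blow_up_mapD(1)[OF *(2)] assms(6,7,8)
    by (intro blow_up_map_extend[OF *(2) assms(2-5)]) auto
  ultimately show ?thesis unfolding contains_blow_up_def by blast
qed

lemma obtain_inj_into:
  assumes "t \<le> card Y" "0 < t"
  obtains y :: "nat \<Rightarrow> 'b" where "inj_on y {..<t}" "\<And>j. j < t \<Longrightarrow> y j \<in> Y"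
proof -
  have "finite Y" using assms card.infinite by fastforce
  then obtain y where "bij_betw y {0..<card Y} Y" using ex_bij_betw_nat_finite by blast
  then have y: "inj_on y {0..<card Y}" "y ` {0..<card Y} = Y" by (auto simp: bij_betw_def)
  show thesis
  proof (rule that)
    show "inj_on y {..<t}" using y(1) by (rule inj_on_subset) (use assms(1) in auto)
    show "y j \<in> Y" if "j < t" for j using y(2) assms(1) that by force
  qed
qed

text \<open>Without a neighbour in \<open>V\<close>, the vertex \<open>v\<close> can form the new
  class \<open>Suc q\<close> alone, on any \<open>t\<close> vertices of \<open>B v\<close>.\<close>

lemma blow_up_add_class:
  assumes "contains_blow_up q t V E A R" "sym E" "irrefl E" "sym R" "v \<notin> V"
    and "\<And>u. u \<in> V \<Longrightarrow> A u \<subseteq> B u"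
    and "\<And>u. u \<in> V \<Longrightarrow> (v, u) \<notin> E"
    and "t \<le> card (B v)" "0 < t"
  shows "contains_blow_up (Suc q) t (insert v V) E B R"
proof -
  obtain \<kappa> \<Phi> where *: "labelling q V E \<kappa>" "blow_up_map t V E A R \<kappa> \<Phi>"
    using assms(1) unfolding contains_blow_up_def by blast
  obtain y where y: "inj_on y {..<t}" "\<And>j. j < t \<Longrightarrow> y j \<in> B v"
    using obtain_inj_into[OF assms(8,9)] by blast
  have "labelling (Suc q) (insert v V) E (\<kappa>(v := Suc q))"
    using * assms by (intro labelling_extend[of q]) auto
  moreover have "blow_up_map t (insert v V) E B R (\<kappa>(v := Suc q)) (\<Phi>(v := y))"
    using assms(6,7) y
    by (intro blow_up_map_extend[OF *(2) assms(2-5)]) auto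
  ultimately show ?thesis unfolding contains_blow_up_def by blast
qed

text \<open>Choose one neighbour in \<open>B v\<close> for each image of \<open>w\<close>. Of the
  \<open>t * t\<close> copies, \<open>t\<close> can be kept in which these neighbours are all
  distinct, so that \<open>v\<close> joins the class of \<open>w\<close>, or all equal, so that
  \<open>v\<close> gets label 0.\<close>

lemma blow_up_add_pendant:
  assumes "contains_blow_up q (t * t) V E A R" "sym E" "irrefl E" "sym R" "v \<notin> V" "0 < t"
    and sub: "\<And>u. u \<in> V \<Longrightarrow> A u \<subseteq> B u"
    and w: "w \<in> V" "\<And>u. u \<in> V \<Longrightarrow> (v, u) \<in> E \<Longrightarrow> u = w"
    and nbr: "\<And>z. z \<in> A w \<Longrightarrow> \<exists>y\<in>B v. (z, y) \<in> R"
  shows "contains_blow_up q t (insert v V) E B R"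
proof -
  obtain \<kappa> \<Phi> where \<kappa>: "labelling q V E \<kappa>" and \<Phi>: "blow_up_map (t * t) V E A R \<kappa> \<Phi>"
    using assms(1) unfolding contains_blow_up_def by blast
  have bound: "\<kappa> w \<le> q" by (rule labellingD(1)[OF \<kappa> w(1)])
  define y where "y z = (SOME y. y \<in> B v \<and> (z, y) \<in> R)" for z
  have y: "y z \<in> B v \<and> (z, y z) \<in> R" if "z \<in> A w" for z
  proof -
    have "\<exists>y. y \<in> B v \<and> (z, y) \<in> R" using nbr[OF that] by blast
    then show ?thesis unfolding y_def by (rule someI_ex)
  qed
  obtain g where g: "inj_on g {..<t}" "g ` {..<t} \<subseteq> {..<t * t}"
    "inj_on (\<lambda>j. y (\<Phi> w (g j))) {..<t} \<or> (\<exists>c. \<forall>j<t. y (\<Phi> w (g j)) = c)"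
    by (rule pigeonhole_square[OF assms(6), of "\<lambda>j. y (\<Phi> w j)"])
  let ?\<Phi> = "\<lambda>v j. \<Phi> v (g j)"
  have \<Phi>': "blow_up_map t V E A R \<kappa> ?\<Phi>"
    by (rule blow_up_map_reindex[OF \<Phi> g(1,2)])
  have inA: "?\<Phi> w j \<in> A w" if "j < t" for j using blow_up_mapD(1)[OF \<Phi>' w(1) that] .
  \<comment> \<open>If \<open>w\<close> has label 0, its image and hence the chosen neighbour are
    constant, so label 0 is right for \<open>v\<close> in either branch.\<close>
  define k where "k = (if inj_on (\<lambda>j. y (\<Phi> w (g j))) {..<t} then \<kappa> w else 0)"
  have k: "k = 0 \<and> (\<exists>c. \<forall>j<t. y (?\<Phi> w j) = c) \<or> k \<noteq> 0 \<and> inj_on (\<lambda>j. y (?\<Phi> w j)) {..<t}"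
  proof (cases "inj_on (\<lambda>j. y (\<Phi> w (g j))) {..<t} \<and> \<kappa> w = 0")
    case True
    have "\<forall>j<t. y (?\<Phi> w j) = y (?\<Phi> w 0)"
    proof (intro allI impI)
      fix j assume "j < t"
      then show "y (?\<Phi> w j) = y (?\<Phi> w 0)"
        using blow_up_mapD(2)[OF \<Phi>' w(1), of j 0] True assms(6) by simp
    qed
    then show ?thesis using True unfolding k_def by (simp only: simp_thms if_True) blast
  next
    case False
    then show ?thesis using g(3) unfolding k_def by (simp split: if_splits) blast
  qed
  have "labelling q (insert v V) E (\<kappa>(v := k))"
  proof (rule labelling_extend[OF \<kappa> assms(2,3,5)])
    show "k \<le> q" using bound by (simp add: k_def)
    show "k = \<kappa> u \<or> k = 0 \<or> \<kappa> u = 0" if "u \<in> V" "(v, u) \<in> E" for u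
      using w(2)[OF that] by (simp add: k_def)
  qed auto
  moreover have "blow_up_map t (insert v V) E B R (\<kappa>(v := k)) (?\<Phi>(v := \<lambda>j. y (?\<Phi> w j)))"
  proof (rule blow_up_map_extend[OF \<Phi>' assms(2-5) sub _ k])
    show "y (?\<Phi> w j) \<in> B v" if "j < t" for j using y[OF inA[OF that]] by blast
    show "(?\<Phi> u j, y (?\<Phi> w j)) \<in> R" if "u \<in> V" "j < t" "(v, u) \<in> E" for u j
      using y[OF inA[OF that(2)]] w(2)[OF that(1,3)] by simp
  qed
  ultimately show ?thesis unfolding contains_blow_up_def by blast
qed

section \<open>Counting partite homomorphisms; thresholds that force a blow-up\<close>

lemma card_homs_insert:
  assumes "finite V" "\<And>u. u \<in> insert v V \<Longrightarrow> finite (A u)" "v \<notin> V"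
  shows "card (homs (insert v V) E A R) \<le>
    (\<Sum>\<phi>\<in>homs V E A R. card {y \<in> A v. \<forall>u\<in>V. (u, v) \<in> E \<longrightarrow> (\<phi> u, y) \<in> R})"
proof -
  let ?Y = "\<lambda>\<phi>. {y \<in> A v. \<forall>u\<in>V. (u, v) \<in> E \<longrightarrow> (\<phi> u, y) \<in> R}"
  let ?f = "\<lambda>\<phi>. (restrict \<phi> V, \<phi> v)"
  have fin: "finite (homs V E A R)" using assms by (intro finite_homs) auto
  have finY: "finite (?Y \<phi>)" for \<phi> using assms(2)[of v] by simp
  have "inj_on ?f (homs (insert v V) E A R)"
  proof (rule inj_onI)
    fix \<phi> \<psi> assume *: "\<phi> \<in> homs (insert v V) E A R" "\<psi> \<in> homs (insert v V) E A R" "?f \<phi> = ?f \<psi>"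
    show "\<phi> = \<psi>"
    proof (rule PiE_ext[of _ "insert v V" A])
      show "\<phi> \<in> Pi\<^sub>E (insert v V) A" "\<psi> \<in> Pi\<^sub>E (insert v V) A" using * by (auto simp: homs_def)
      fix x assume "x \<in> insert v V"
      then show "\<phi> x = \<psi> x" using *(3) by (auto simp: restrict_def fun_eq_iff) metis
    qed
  qed
  moreover have "?f ` homs (insert v V) E A R \<subseteq> Sigma (homs V E A R) ?Y"
  proof
    fix z assume "z \<in> ?f ` homs (insert v V) E A R"
    then obtain \<phi> where \<phi>: "\<phi> \<in> homs (insert v V) E A R" "z = ?f \<phi>" by blast
    have "insert v V - {v} = V" using assms(3) by blast
    then have "restrict \<phi> V \<in> homs V E A R" using homs_remove[OF \<phi>(1), of "{v}"] by simp
    moreover have "\<phi> v \<in> ?Y (restrict \<phi> V)" using \<phi>(1) by (auto simp: homs_def)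
    ultimately show "z \<in> Sigma (homs V E A R) ?Y" using \<phi>(2) by blast
  qed
  ultimately have "card (homs (insert v V) E A R) \<le> card (Sigma (homs V E A R) ?Y)"
    using fin finY by (intro card_inj_on_le) auto
  also have "\<dots> = (\<Sum>\<phi>\<in>homs V E A R. card (?Y \<phi>))"
    using fin finY by (intro card_SigmaI) auto
  finally show ?thesis .
qed

text \<open>Once \<open>w\<close> is sent to \<open>x\<close>, the neighbours of \<open>w\<close>
  are confined to neighbours of \<open>x\<close>, and the restriction to the other vertices
  determines the map.\<close>

lemma card_homs_fix:
  assumes "finite V" "\<And>u. u \<in> V \<Longrightarrow> finite (A u)" "w \<in> V"
  shows "card {\<phi> \<in> homs V E A R. \<phi> w = x} \<le>
    card (homs (V - {w}) E (\<lambda>u. if (w, u) \<in> E then {z \<in> A u. (x, z) \<in> R} else A u) R)"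
    (is "_ \<le> card (homs _ E ?A R)")
proof (rule card_inj_on_le[of "\<lambda>\<phi>. restrict \<phi> (V - {w})"])
  show "finite (homs (V - {w}) E ?A R)" using assms by (intro finite_homs) auto
  show "inj_on (\<lambda>\<phi>. restrict \<phi> (V - {w})) {\<phi> \<in> homs V E A R. \<phi> w = x}"
  proof (rule inj_onI)
    fix \<phi> \<psi> assume *: "\<phi> \<in> {\<phi> \<in> homs V E A R. \<phi> w = x}" "\<psi> \<in> {\<phi> \<in> homs V E A R. \<phi> w = x}"
      "restrict \<phi> (V - {w}) = restrict \<psi> (V - {w})"
    show "\<phi> = \<psi>"
    proof (rule PiE_ext[of _ V A])
      show "\<phi> \<in> Pi\<^sub>E V A" "\<psi> \<in> Pi\<^sub>E V A" using * by (auto simp: homs_def)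
      fix u assume "u \<in> V"
      then show "\<phi> u = \<psi> u" using *(1,2) fun_cong[OF *(3), of u] by (cases "u = w") auto
    qed
  qed
  show "(\<lambda>\<phi>. restrict \<phi> (V - {w})) ` {\<phi> \<in> homs V E A R. \<phi> w = x} \<subseteq> homs (V - {w}) E ?A R"
    using assms(3) by (auto simp: homs_def PiE_iff extensional_def)
qed

text \<open>The threshold is \<open>C * n ^ (q - 1)\<close> homomorphisms; the factor
  \<open>n\<close> on the right avoids the truncated exponent at \<open>q = 0\<close>. One constant
  serves all hosts on the vertex type \<open>'b\<close>, which the \<open>itself\<close> argument
  fixes.\<close>

definition blow_up_bound ::
  "nat \<Rightarrow> nat \<Rightarrow> nat \<Rightarrow> 'a set \<Rightarrow> 'a rel \<Rightarrow> 'b itself \<Rightarrow> nat \<Rightarrow> bool" where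
  "blow_up_bound d q t V E _ C \<longleftrightarrow>
    (\<forall>n (A :: 'a \<Rightarrow> 'b set) R. sym R \<longrightarrow> (\<forall>v\<in>V. finite (A v) \<and> card (A v) \<le> n) \<longrightarrow>
      (\<forall>u\<in>V. \<forall>v\<in>V. (u, v) \<in> E \<longrightarrow> card (R \<inter> A u \<times> A v) \<le> d * n) \<longrightarrow>
      C * n ^ q < n * card (homs V E A R) \<longrightarrow> contains_blow_up q t V E A R)"

lemma blow_up_boundD:
  fixes A :: "'a \<Rightarrow> 'b set"
  assumes "blow_up_bound d q t V E TYPE('b) C" "sym R" "\<And>v. v \<in> V \<Longrightarrow> finite (A v)"
    "\<And>v. v \<in> V \<Longrightarrow> card (A v) \<le> n"
    "\<And>u v. u \<in> V \<Longrightarrow> v \<in> V \<Longrightarrow> (u, v) \<in> E \<Longrightarrow> card (R \<inter> A u \<times> A v) \<le> d * n"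
    "C * n ^ q < n * card (homs V E A R)"
  shows "contains_blow_up q t V E A R"
  using assms unfolding blow_up_bound_def by blast

lemma blow_up_bound_0: "blow_up_bound d 0 t V E TYPE('b) C"
  unfolding blow_up_bound_def
proof (intro allI impI)
  fix n and A :: "'a \<Rightarrow> 'b set" and R
  assume "C * n ^ 0 < n * card (homs V E A R)"
  then have "homs V E A R \<noteq> {}" by (intro notI) simp
  then show "contains_blow_up 0 t V E A R" using contains_blow_up_0 by blast
qed

lemma blow_up_bound_empty: "blow_up_bound d (Suc q) t {} E TYPE('b) 1"
  unfolding blow_up_bound_def
proof (intro allI impI)
  fix n and A :: "'a \<Rightarrow> 'b set" and R :: "'b rel"
  assume *: "1 * n ^ Suc q < n * card (homs {} E A R)"
  have "homs {} E A R \<subseteq> {\<lambda>x. undefined}" unfolding homs_def by auto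
  then have "card (homs {} E A R) \<le> 1" using card_mono[of "{\<lambda>x. undefined}"] by simp
  then have "n * card (homs {} E A R) \<le> n" by simp
  moreover have "n \<le> n ^ Suc q" by (cases "n = 0") (simp_all add: self_le_power)
  ultimately show "contains_blow_up (Suc q) t {} E A R" using * by linarith
qed

text \<open>If \<open>A v\<close> has at least \<open>t\<close> elements, \<open>v\<close> becomes a
  class on top of \<open>q\<close> classes of \<open>V\<close>. Otherwise forgetting
  \<open>v\<close> costs at most a factor \<open>t\<close>, so \<open>V\<close> alone has
  \<open>Suc q\<close> classes, and \<open>v\<close> is fixed anywhere in
  \<open>A v\<close>.\<close>

lemma blow_up_bound_isolated:
  assumes V: "finite V" "v \<notin> V" "sym E" "irrefl E" "\<And>u. u \<in> V \<Longrightarrow> (v, u) \<notin> E" "0 < t"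
    and C1: "blow_up_bound d q t V E TYPE('b) C1"
    and C2: "blow_up_bound d (Suc q) t V E TYPE('b) C2"
  shows "blow_up_bound d (Suc q) t (insert v V) E TYPE('b) (C1 + t * C2)"
  unfolding blow_up_bound_def
proof (intro allI impI)
  fix n and A :: "'a \<Rightarrow> 'b set" and R :: "'b rel"
  assume R: "sym R" and A: "\<forall>v\<in>insert v V. finite (A v) \<and> card (A v) \<le> n"
    and e: "\<forall>u\<in>insert v V. \<forall>w\<in>insert v V. (u, w) \<in> E \<longrightarrow> card (R \<inter> A u \<times> A w) \<le> d * n"
    and big: "(C1 + t * C2) * n ^ Suc q < n * card (homs (insert v V) E A R)"
  let ?N = "card (homs V E A R)"
  have "card (homs (insert v V) E A R) \<le>
    (\<Sum>\<phi>\<in>homs V E A R. card {y \<in> A v. \<forall>u\<in>V. (u, v) \<in> E \<longrightarrow> (\<phi> u, y) \<in> R})"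
    using V A by (intro card_homs_insert) auto
  also have "\<dots> \<le> (\<Sum>\<phi>\<in>homs V E A R. card (A v))"
    using A by (intro sum_mono card_mono) auto
  finally have le: "card (homs (insert v V) E A R) \<le> ?N * card (A v)" by simp
  have pos: "0 < n * card (homs (insert v V) E A R)" using big by linarith
  then have "A v \<noteq> {}" using le by (intro notI) simp
  then obtain x where x: "x \<in> A v" by blast
  show "contains_blow_up (Suc q) t (insert v V) E A R"
  proof (cases "t \<le> card (A v)")
    case True
    have "n * (C1 * n ^ q) = C1 * n ^ Suc q" by simp
    also have "\<dots> \<le> (C1 + t * C2) * n ^ Suc q" by (intro mult_right_mono) auto
    also note big
    also have "n * card (homs (insert v V) E A R) \<le> n * (?N * card (A v))"
      using le by (rule mult_left_mono) simp
    also have "\<dots> \<le> n * (?N * n)" using A by (intro mult_left_mono) auto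
    finally have "C1 * n ^ q < n * ?N" using pos by (simp add: mult.commute)
    then have "contains_blow_up q t V E A R"
      using A e R by (intro blow_up_boundD[OF C1]) auto
    then show ?thesis
      by (rule blow_up_add_class) (use V R True in auto)
  next
    case False
    have "t * (C2 * n ^ Suc q) = (t * C2) * n ^ Suc q" by simp
    also have "\<dots> \<le> (C1 + t * C2) * n ^ Suc q" by (intro mult_right_mono) auto
    also note big
    also have "n * card (homs (insert v V) E A R) \<le> n * (?N * card (A v))"
      using le by (rule mult_left_mono) simp
    also have "\<dots> \<le> n * (?N * t)" using False by (intro mult_left_mono) auto
    also have "\<dots> = t * (n * ?N)" by simp
    finally have "C2 * n ^ Suc q < n * ?N" using V(6) by simp
    then have "contains_blow_up (Suc q) t V E A R"
      using A e R by (intro blow_up_boundD[OF C2]) auto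
    then show ?thesis
      by (rule blow_up_add_fixed[where x = x]) (use V R x in auto)
  qed
qed

text \<open>The number of extensions of \<open>\<phi>\<close> to \<open>v\<close> is the degree of
  \<open>\<phi> w\<close> into \<open>A v\<close>. Images of degree at least \<open>t\<close> are
  controlled by \<open>few\<close> and the number of arcs; all others give fewer than
  \<open>t\<close> extensions.\<close>

lemma card_homs_pendant_le:
  fixes A :: "'a \<Rightarrow> 'b set" and R :: "'b rel"
  assumes V: "finite V" "v \<notin> V" "w \<in> V" "(w, v) \<in> E" and "sym E"
    and nbr: "\<And>u. u \<in> V \<Longrightarrow> (u, v) \<in> E \<Longrightarrow> u = w"
    and A: "\<And>u. u \<in> insert v V \<Longrightarrow> finite (A u)"
    and edges: "card (R \<inter> A w \<times> A v) \<le> d * n"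
    and deg: "\<And>x. deg x = card {y \<in> A v. (x, y) \<in> R}"
    and few: "\<And>x. x \<in> A w \<Longrightarrow> t \<le> deg x \<Longrightarrow> n * card {\<phi> \<in> homs V E A R. \<phi> w = x} \<le> K"
  shows "n * card (homs (insert v V) E A R) \<le>
    d * n * K + t * (n * card (homs V E (A(w := {x \<in> A w. 1 \<le> deg x})) R))"
proof -
  let ?H = "homs V E A R" and ?A = "A(w := {x \<in> A w. 1 \<le> deg x})"
  let ?big = "{\<phi> \<in> ?H. t \<le> deg (\<phi> w)}" and ?small = "{\<phi> \<in> ?H. deg (\<phi> w) < t}"
  let ?W = "{x \<in> A w. t \<le> deg x}"
  have finH: "finite ?H" using V A by (intro finite_homs) auto
  have "card (homs (insert v V) E A R) \<le>
    (\<Sum>\<phi>\<in>?H. card {y \<in> A v. \<forall>u\<in>V. (u, v) \<in> E \<longrightarrow> (\<phi> u, y) \<in> R})"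
    using V A by (intro card_homs_insert) auto
  also have "\<dots> = (\<Sum>\<phi>\<in>?H. deg (\<phi> w))"
  proof (rule sum.cong[OF refl])
    fix \<phi>
    have "{y \<in> A v. \<forall>u\<in>V. (u, v) \<in> E \<longrightarrow> (\<phi> u, y) \<in> R} = {y \<in> A v. (\<phi> w, y) \<in> R}"
      using V(3,4) nbr by blast
    then show "card {y \<in> A v. \<forall>u\<in>V. (u, v) \<in> E \<longrightarrow> (\<phi> u, y) \<in> R} = deg (\<phi> w)"
      by (simp add: deg)
  qed
  also have "\<dots> = (\<Sum>\<phi>\<in>?big. deg (\<phi> w)) + (\<Sum>\<phi>\<in>?small. deg (\<phi> w))"
  proof (subst sum.union_disjoint[symmetric])
    have "?H = ?big \<union> ?small" by auto
    then show "(\<Sum>\<phi>\<in>?H. deg (\<phi> w)) = (\<Sum>\<phi>\<in>?big \<union> ?small. deg (\<phi> w))" by simp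
  qed (use finH in auto)
  finally have total: "card (homs (insert v V) E A R) \<le>
    (\<Sum>\<phi>\<in>?big. deg (\<phi> w)) + (\<Sum>\<phi>\<in>?small. deg (\<phi> w))" .
  have inA: "\<phi> w \<in> A w" if "\<phi> \<in> ?H" for \<phi> using that V(3) by (auto simp: homs_def)
  have finW: "finite (A w)" using A V by blast
  have "(\<Sum>\<phi>\<in>?small. deg (\<phi> w)) \<le> (\<Sum>\<phi>\<in>{\<phi> \<in> ?H. 1 \<le> deg (\<phi> w)}. t)"
  proof -
    \<comment> \<open>Maps without an extension contribute nothing. Dropping them lets the part of
      \<open>w\<close> shrink to vertices with a neighbour in \<open>A v\<close>.\<close>
    have "(\<Sum>\<phi>\<in>?small. deg (\<phi> w)) = (\<Sum>\<phi>\<in>{\<phi> \<in> ?small. 1 \<le> deg (\<phi> w)}. deg (\<phi> w))"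
      using finH by (intro sum.mono_neutral_right) auto
    also have "\<dots> \<le> (\<Sum>\<phi>\<in>{\<phi> \<in> ?small. 1 \<le> deg (\<phi> w)}. t)" by (intro sum_mono) auto
    also have "\<dots> \<le> (\<Sum>\<phi>\<in>{\<phi> \<in> ?H. 1 \<le> deg (\<phi> w)}. t)"
      using finH by (intro sum_mono2) auto
    finally show ?thesis .
  qed
  also have "\<dots> = card {\<phi> \<in> ?H. 1 \<le> deg (\<phi> w)} * t" by simp
  also have "\<dots> \<le> card (homs V E ?A R) * t"
  proof (intro mult_right_mono card_mono)
    show "finite (homs V E ?A R)" using V A by (intro finite_homs) auto
    show "{\<phi> \<in> ?H. 1 \<le> deg (\<phi> w)} \<subseteq> homs V E ?A R"
      by (auto simp: homs_def PiE_iff)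
  qed simp
  finally have small: "(\<Sum>\<phi>\<in>?small. deg (\<phi> w)) \<le> card (homs V E ?A R) * t" .
  have "(\<Sum>\<phi>\<in>?big. deg (\<phi> w)) = (\<Sum>x\<in>?W. \<Sum>\<phi>\<in>{\<phi> \<in> ?big. \<phi> w = x}. deg (\<phi> w))"
    using finH finW inA by (intro sum.group[symmetric]) auto
  also have "\<dots> \<le> (\<Sum>x\<in>?W. deg x * card {\<phi> \<in> ?H. \<phi> w = x})"
  proof (rule sum_mono)
    fix x
    have "(\<Sum>\<phi>\<in>{\<phi> \<in> ?big. \<phi> w = x}. deg (\<phi> w)) = deg x * card {\<phi> \<in> ?big. \<phi> w = x}"
      by simp
    also have "\<dots> \<le> deg x * card {\<phi> \<in> ?H. \<phi> w = x}"
      using finH by (intro mult_left_mono card_mono) auto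
    finally show "(\<Sum>\<phi>\<in>{\<phi> \<in> ?big. \<phi> w = x}. deg (\<phi> w)) \<le> deg x * card {\<phi> \<in> ?H. \<phi> w = x}" .
  qed
  finally have "n * (\<Sum>\<phi>\<in>?big. deg (\<phi> w)) \<le> n * (\<Sum>x\<in>?W. deg x * card {\<phi> \<in> ?H. \<phi> w = x})"
    by (rule mult_left_mono) simp
  also have "\<dots> = (\<Sum>x\<in>?W. deg x * (n * card {\<phi> \<in> ?H. \<phi> w = x}))"
    by (simp add: sum_distrib_left mult.left_commute)
  also have "\<dots> \<le> (\<Sum>x\<in>?W. deg x * K)" using few by (intro sum_mono mult_left_mono) auto
  also have "\<dots> = (\<Sum>x\<in>?W. deg x) * K" by (simp add: sum_distrib_right)
  also have "\<dots> \<le> (\<Sum>x\<in>A w. deg x) * K" using finW by (intro mult_right_mono sum_mono2) auto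
  \<comment> \<open>The degrees add up to the number of arcs from \<open>A w\<close> to
    \<open>A v\<close>; here the sparsity of the host enters.\<close>
  also have "(\<Sum>x\<in>A w. deg x) = card (SIGMA x:A w. {y \<in> A v. (x, y) \<in> R})"
    unfolding deg using A finW by (subst card_SigmaI) auto
  also have "(SIGMA x:A w. {y \<in> A v. (x, y) \<in> R}) = R \<inter> A w \<times> A v" by auto
  also have "card (R \<inter> A w \<times> A v) * K \<le> d * n * K" using edges by (rule mult_right_mono) simp
  finally have big: "n * (\<Sum>\<phi>\<in>?big. deg (\<phi> w)) \<le> d * n * K" .
  have "n * card (homs (insert v V) E A R) \<le>
      n * ((\<Sum>\<phi>\<in>?big. deg (\<phi> w)) + (\<Sum>\<phi>\<in>?small. deg (\<phi> w)))"
    using total by (rule mult_left_mono) simp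
  also have "\<dots> \<le> n * (\<Sum>\<phi>\<in>?big. deg (\<phi> w)) + n * (card (homs V E ?A R) * t)"
    using mult_left_mono[OF small, of n] by (simp add: distrib_left)
  also have "\<dots> \<le> d * n * K + n * (card (homs V E ?A R) * t)" using big by (rule add_right_mono)
  also have "n * (card (homs V E ?A R) * t) = t * (n * card (homs V E ?A R))" by simp
  finally show ?thesis .
qed

text \<open>If some image \<open>x\<close> of \<open>w\<close> has degree at least \<open>t\<close>
  and lies in many homomorphisms, \<open>w\<close> is fixed at \<open>x\<close> and \<open>v\<close>
  becomes a new class among the neighbours of \<open>x\<close>. Otherwise the count passes to
  \<open>V\<close>, with \<open>w\<close> confined to vertices that have a neighbour in
  \<open>A v\<close>, and \<open>v\<close> is attached afterwards, which takes \<open>t * t\<close>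
  copies.\<close>

lemma blow_up_bound_pendant:
  assumes V: "finite V" "v \<notin> V" "w \<in> V" "sym E" "irrefl E" "0 < t"
    and nbr: "\<And>u. u \<in> V \<Longrightarrow> (v, u) \<in> E \<longleftrightarrow> u = w"
    and C1: "blow_up_bound d q t (V - {w}) E TYPE('b) C1"
    and C2: "blow_up_bound d (Suc q) (t * t) V E TYPE('b) C2"
  shows "blow_up_bound d (Suc q) t (insert v V) E TYPE('b) (d * C1 + t * C2)"
  unfolding blow_up_bound_def
proof (intro allI impI)
  fix n and A :: "'a \<Rightarrow> 'b set" and R :: "'b rel"
  assume R: "sym R" and A: "\<forall>v\<in>insert v V. finite (A v) \<and> card (A v) \<le> n"
    and e: "\<forall>u\<in>insert v V. \<forall>w\<in>insert v V. (u, w) \<in> E \<longrightarrow> card (R \<inter> A u \<times> A w) \<le> d * n"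
    and big: "(d * C1 + t * C2) * n ^ Suc q < n * card (homs (insert v V) E A R)"
  define deg where "deg x = card {y \<in> A v. (x, y) \<in> R}" for x
  have E: "(w, v) \<in> E" "(v, w) \<in> E" using nbr[OF V(3)] symD[OF V(4)] by blast+
  have nbr': "u = w" if "u \<in> V" "(u, v) \<in> E" for u using nbr[OF that(1)] that(2) symD[OF V(4)] by blast
  show "contains_blow_up (Suc q) t (insert v V) E A R"
  proof (cases "\<exists>x\<in>A w. t \<le> deg x \<and> C1 * n ^ q < n * card {\<phi> \<in> homs V E A R. \<phi> w = x}")
    case True
    then obtain x where x: "x \<in> A w" "t \<le> deg x"
        "C1 * n ^ q < n * card {\<phi> \<in> homs V E A R. \<phi> w = x}" by blast
    let ?A = "\<lambda>u. if (w, u) \<in> E then {z \<in> A u. (x, z) \<in> R} else A u"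
    note x(3)
    also have "n * card {\<phi> \<in> homs V E A R. \<phi> w = x} \<le> n * card (homs (V - {w}) E ?A R)"
      using A V by (intro mult_left_mono card_homs_fix) auto
    finally have many: "C1 * n ^ q < n * card (homs (V - {w}) E ?A R)" .
    have "contains_blow_up q t (V - {w}) E ?A R"
    proof (rule blow_up_boundD[OF C1 R _ _ _ many])
      fix u assume u: "u \<in> V - {w}"
      then show "finite (?A u)" using A by simp
      have "card (?A u) \<le> card (A u)" using A u by (intro card_mono) auto
      then show "card (?A u) \<le> n" using A u by (meson DiffD1 insertI2 le_trans)
    next
      fix u u' assume *: "u \<in> V - {w}" "u' \<in> V - {w}" "(u, u') \<in> E"
      have "card (R \<inter> ?A u \<times> ?A u') \<le> card (R \<inter> A u \<times> A u')"
        using A * by (intro card_mono) auto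
      then show "card (R \<inter> ?A u \<times> ?A u') \<le> d * n" using e * by (meson DiffD1 insertI2 le_trans)
    qed
    \<comment> \<open>\<open>v\<close> comes before \<open>w\<close>: in the absence of
      \<open>w\<close> it has no neighbour. Then \<open>w\<close> can be fixed at \<open>x\<close>,
      as the parts of its neighbours consist of neighbours of \<open>x\<close>.\<close>
    then have "contains_blow_up (Suc q) t (insert v (V - {w})) E ?A R"
    proof (rule blow_up_add_class)
      show "(v, u) \<notin> E" if "u \<in> V - {w}" for u using that nbr[of u] by blast
      show "t \<le> card (?A v)" using x(2) E by (simp add: deg_def)
    qed (use V R in auto)
    then have "contains_blow_up (Suc q) t (insert w (insert v (V - {w}))) E A R"
      by (rule blow_up_add_fixed[where x = x]) (use V R x(1) in \<open>auto dest: symD\<close>)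
    moreover have "insert w (insert v (V - {w})) = insert v V" using V(3) by blast
    ultimately show ?thesis by simp
  next
    case False
    let ?A = "A(w := {x \<in> A w. 1 \<le> deg x})"
    have few: "n * card {\<phi> \<in> homs V E A R. \<phi> w = x} \<le> C1 * n ^ q" if "x \<in> A w" "t \<le> deg x" for x
      using False that by (auto simp: not_less)
    note big
    also have "n * card (homs (insert v V) E A R) \<le> d * n * (C1 * n ^ q) + t * (n * card (homs V E ?A R))"
    proof (rule card_homs_pendant_le)
      show "finite (A u)" if "u \<in> insert v V" for u using A that by blast
      show "card (R \<inter> A w \<times> A v) \<le> d * n" using e E(1) V(3) by blast
    qed (use V E nbr' few deg_def in blast)+
    \<comment> \<open>The first summand equals \<open>d * C1 * n ^ Suc q\<close>, so
      \<open>big\<close> leaves more than \<open>t * C2 * n ^ Suc q\<close> for the second.\<close>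
    finally have "t * (C2 * n ^ Suc q) < t * (n * card (homs V E ?A R))"
      by (simp add: algebra_simps)
    then have many: "C2 * n ^ Suc q < n * card (homs V E ?A R)" using V(6) by simp
    have "contains_blow_up (Suc q) (t * t) V E ?A R"
    proof (rule blow_up_boundD[OF C2 R _ _ _ many])
      fix u assume u: "u \<in> V"
      then show "finite (?A u)" using A V(3) by auto
      have "card (?A u) \<le> card (A u)" using A u by (intro card_mono) auto
      then show "card (?A u) \<le> n" using A u by (meson insertI2 le_trans)
    next
      fix u u' assume *: "u \<in> V" "u' \<in> V" "(u, u') \<in> E"
      have "card (R \<inter> ?A u \<times> ?A u') \<le> card (R \<inter> A u \<times> A u')"
        using A * by (intro card_mono) (auto split: if_splits)
      then show "card (R \<inter> ?A u \<times> ?A u') \<le> d * n" using e * by (meson insertI2 le_trans)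
    qed
    then show ?thesis
    proof (rule blow_up_add_pendant[where w = w])
      show "?A u \<subseteq> A u" for u by auto
      show "\<exists>y\<in>A v. (z, y) \<in> R" if "z \<in> ?A w" for z
      proof -
        have "deg z \<noteq> 0" using that by auto
        then have "{y \<in> A v. (z, y) \<in> R} \<noteq> {}" unfolding deg_def by (metis card.empty)
        then show ?thesis by blast
      qed
    qed (use V R nbr in auto)
  qed
qed


text \<open>Induction on \<open>V\<close>, removing an isolated or pendant vertex. \<open>t\<close>
  has to vary because a pendant vertex asks for \<open>t * t\<close> copies, and \<open>q\<close>
  because a new class leaves one class fewer to the rest.\<close>

lemma blow_up_bound_exists:
  assumes "finite V" "one_degenerate V E" "sym E" "irrefl E" "0 < t"
  shows "\<exists>C. blow_up_bound d q t V E TYPE('b) C"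
  using assms(1,2,5)
proof (induction V arbitrary: q t rule: finite_psubset_induct)
  case (psubset V)
  have IH: "\<exists>C. blow_up_bound d p s W E TYPE('b) C" if "W \<subset> V" "0 < s" for W p s
    using psubset.IH[OF that(1) one_degenerate_mono[OF psubset.prems(1)] that(2)] that(1) by blast
  show ?case
  proof (cases q)
    case 0
    then show ?thesis using blow_up_bound_0 by blast
  next
    case (Suc p)
    show ?thesis
    proof (cases "V = {}")
      case True
      then show ?thesis using blow_up_bound_empty Suc by blast
    next
      case False
      show ?thesis
      proof (rule one_degenerate_cases[OF psubset.hyps(1) False psubset.prems(1)])
        fix v assume v: "v \<in> V" "\<And>u. u \<in> V \<Longrightarrow> (v, u) \<notin> E"
        have W: "V - {v} \<subset> V" "insert v (V - {v}) = V" using v(1) by blast+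
        obtain C1 C2 where "blow_up_bound d p t (V - {v}) E TYPE('b) C1"
          "blow_up_bound d (Suc p) t (V - {v}) E TYPE('b) C2"
          using IH[OF W(1) psubset.prems(2)] by meson
        then have "blow_up_bound d (Suc p) t (insert v (V - {v})) E TYPE('b) (C1 + t * C2)"
          using v psubset assms(3,4) by (intro blow_up_bound_isolated) auto
        then show ?thesis using W(2) Suc by auto
      next
        fix v w assume v: "v \<in> V" "w \<in> V" "\<And>u. u \<in> V \<Longrightarrow> (v, u) \<in> E \<longleftrightarrow> u = w"
        have "v \<noteq> w" using v(3)[OF v(2)] assms(4) by (auto simp: irrefl_def)
        have W: "V - {v} \<subset> V" "V - {v} - {w} \<subset> V" "insert v (V - {v}) = V" using v(1) by blast+
        have "0 < t * t" using psubset.prems(2) by simp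
        then obtain C1 C2 where "blow_up_bound d p t (V - {v} - {w}) E TYPE('b) C1"
          "blow_up_bound d (Suc p) (t * t) (V - {v}) E TYPE('b) C2"
          using IH[OF W(2) psubset.prems(2)] IH[OF W(1)] by meson
        then have "blow_up_bound d (Suc p) t (insert v (V - {v})) E TYPE('b) (d * C1 + t * C2)"
          using v psubset assms(3,4) \<open>v \<noteq> w\<close> by (intro blow_up_bound_pendant) auto
        then show ?thesis using W(3) Suc by auto
      qed
    qed
  qed
qed

subsection \<open>Embeddings and copies\<close>

text \<open>Subgraph containment on bare sets and relations. \<open>R\<close> may have arcs outside
  \<open>X\<close>, so passing to a vertex subset leaves \<open>R\<close> unchanged.\<close>

definition embeds :: "'a set \<Rightarrow> 'a rel \<Rightarrow> 'b set \<Rightarrow> 'b rel \<Rightarrow> bool" where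
  "embeds V E X R \<longleftrightarrow> (\<exists>\<phi>. inj_on \<phi> V \<and> \<phi> ` V \<subseteq> X \<and>
     (\<forall>u\<in>V. \<forall>v\<in>V. (u, v) \<in> E \<longrightarrow> (\<phi> u, \<phi> v) \<in> R))"

lemma embeds_trans:
  assumes "embeds V E X R" "embeds X R Y S"
  shows "embeds V E Y S"
proof -
  obtain \<phi> where \<phi>: "inj_on \<phi> V" "\<phi> ` V \<subseteq> X" "\<forall>u\<in>V. \<forall>v\<in>V. (u, v) \<in> E \<longrightarrow> (\<phi> u, \<phi> v) \<in> R"
    using assms(1) unfolding embeds_def by blast
  obtain \<psi> where \<psi>: "inj_on \<psi> X" "\<psi> ` X \<subseteq> Y" "\<forall>u\<in>X. \<forall>v\<in>X. (u, v) \<in> R \<longrightarrow> (\<psi> u, \<psi> v) \<in> S"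
    using assms(2) unfolding embeds_def by blast
  have "inj_on (\<psi> \<circ> \<phi>) V" using \<phi>(1,2) \<psi>(1) by (meson comp_inj_on inj_on_subset)
  moreover have "(\<psi> \<circ> \<phi>) ` V \<subseteq> Y" using \<phi>(2) \<psi>(2) by auto
  moreover have "\<forall>u\<in>V. \<forall>v\<in>V. (u, v) \<in> E \<longrightarrow> ((\<psi> \<circ> \<phi>) u, (\<psi> \<circ> \<phi>) v) \<in> S"
    using \<phi>(2,3) \<psi>(3) by (simp add: image_subset_iff)
  ultimately show ?thesis unfolding embeds_def by blast
qed

lemma embeds_mono: "embeds V E X R \<Longrightarrow> X \<subseteq> Y \<Longrightarrow> embeds V E Y R"
  unfolding embeds_def by blast

lemma embeds_insert:
  assumes "inj_on \<phi> V" "\<phi> ` V \<subseteq> X" "\<forall>u\<in>V. \<forall>w\<in>V. (u, w) \<in> E \<longrightarrow> (\<phi> u, \<phi> w) \<in> R"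
    "v \<notin> V" "sym E" "irrefl E" "sym R" "y \<in> X" "y \<notin> \<phi> ` V"
    and nbr: "\<And>u. u \<in> V \<Longrightarrow> (v, u) \<in> E \<Longrightarrow> (\<phi> u, y) \<in> R"
  shows "embeds (insert v V) E X R"
  unfolding embeds_def
proof (intro exI[of _ "\<phi>(v := y)"] conjI ballI impI)
  have "(\<phi>(v := y)) ` V = \<phi> ` V" using assms(4) by auto
  then show "inj_on (\<phi>(v := y)) (insert v V)" "(\<phi>(v := y)) ` insert v V \<subseteq> X"
    using assms(1,2,4,8,9) by (auto simp: inj_on_fun_updI)
next
  fix a b assume ab: "a \<in> insert v V" "b \<in> insert v V" "(a, b) \<in> E"
  have "a \<noteq> b" using ab(3) assms(6) by (auto simp: irrefl_def)
  have ba: "(b, a) \<in> E" using ab(3) assms(5) by (meson symD)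
  consider "a = v" "b \<in> V" "b \<noteq> v" | "b = v" "a \<in> V" "a \<noteq> v" | "a \<in> V" "b \<in> V" "a \<noteq> v" "b \<noteq> v"
    using ab \<open>a \<noteq> b\<close> by blast
  then show "((\<phi>(v := y)) a, (\<phi>(v := y)) b) \<in> R"
  proof cases
    case 1
    then have "(\<phi> b, y) \<in> R" using nbr ab(3) by blast
    then show ?thesis using 1 symD[OF assms(7)] by simp
  next
    case 2
    then have "(\<phi> a, y) \<in> R" using nbr ba by blast
    then show ?thesis using 2 by simp
  next
    case 3
    then show ?thesis using assms(3) ab(3) by simp
  qed
qed

lemma forest_embeds_min_degree:
  assumes "finite V" "one_degenerate V E" "sym E" "irrefl E" "sym R" "finite X" "X \<noteq> {}"
    and "\<And>x. x \<in> X \<Longrightarrow> card V \<le> card {y \<in> X. (x, y) \<in> R}"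
  shows "embeds V E X R"
  using assms(1,2,8)
proof (induction V rule: finite_psubset_induct)
  case (psubset V)
  show ?case
  proof (cases "V = {}")
    case True
    then show ?thesis by (simp add: embeds_def)
  next
    case False
    \<comment> \<open>The vertex \<open>x\<close> is one all of whose neighbours are admissible
      places for \<open>v\<close>: the image of \<open>w\<close> if \<open>v\<close> is pendant, any
      vertex of \<open>X\<close> if \<open>v\<close> is isolated.\<close>
    have place: "embeds V E X R" if v: "v \<in> V"
      and *: "\<And>\<phi>. \<phi> ` (V - {v}) \<subseteq> X \<Longrightarrow>
        \<exists>x\<in>X. \<forall>u\<in>V - {v}. \<forall>y. (v, u) \<in> E \<longrightarrow> (x, y) \<in> R \<longrightarrow> (\<phi> u, y) \<in> R" for v
    proof -
      have W: "V - {v} \<subset> V" "insert v (V - {v}) = V" using v by blast+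
      have lt: "card (V - {v}) < card V" using v psubset.hyps(1) by (intro psubset_card_mono) auto
      have "embeds (V - {v}) E X R"
        using psubset.IH[OF W(1) one_degenerate_mono[OF psubset.prems(1)]] W(1) psubset.prems(2) lt
        by (meson less_imp_le order_trans psubset_imp_subset)
      then obtain \<phi> where \<phi>: "inj_on \<phi> (V - {v})" "\<phi> ` (V - {v}) \<subseteq> X"
        "\<forall>a\<in>V - {v}. \<forall>b\<in>V - {v}. (a, b) \<in> E \<longrightarrow> (\<phi> a, \<phi> b) \<in> R"
        unfolding embeds_def by blast
      obtain x where x: "x \<in> X" "\<forall>u\<in>V - {v}. \<forall>y. (v, u) \<in> E \<longrightarrow> (x, y) \<in> R \<longrightarrow> (\<phi> u, y) \<in> R"
        using *[OF \<phi>(2)] by blast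
      have "card (\<phi> ` (V - {v})) < card {y \<in> X. (x, y) \<in> R}"
        using psubset.prems(2)[OF x(1)] lt card_image_le[of "V - {v}" \<phi>] psubset.hyps(1) by simp
      then have "\<not> {y \<in> X. (x, y) \<in> R} \<subseteq> \<phi> ` (V - {v})"
        using card_mono[of "\<phi> ` (V - {v})"] psubset.hyps(1) by (meson finite_Diff finite_imageI not_le)
      then obtain y where y: "y \<in> X" "(x, y) \<in> R" "y \<notin> \<phi> ` (V - {v})" by blast
      have "embeds (insert v (V - {v})) E X R"
        using x(2) y(2) by (intro embeds_insert[OF \<phi> _ assms(3-5) y(1,3)]) auto
      then show ?thesis using W(2) by simp
    qed
    show ?thesis
    proof (rule one_degenerate_cases[OF psubset.hyps(1) False psubset.prems(1)])
      fix v assume "v \<in> V" "\<And>u. u \<in> V \<Longrightarrow> (v, u) \<notin> E"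
      then show ?thesis using assms(7) by (intro place[of v]) auto
    next
      fix v w assume v: "v \<in> V" "w \<in> V" "\<And>u. u \<in> V \<Longrightarrow> (v, u) \<in> E \<longleftrightarrow> u = w"
      have "v \<noteq> w" using v(3)[OF v(2)] assms(4) by (auto simp: irrefl_def)
      show ?thesis
      proof (rule place[OF v(1)])
        fix \<phi> assume "\<phi> ` (V - {v}) \<subseteq> X"
        then have "\<phi> w \<in> X" using v(2) \<open>v \<noteq> w\<close> by blast
        then show "\<exists>x\<in>X. \<forall>u\<in>V - {v}. \<forall>y. (v, u) \<in> E \<longrightarrow> (x, y) \<in> R \<longrightarrow> (\<phi> u, y) \<in> R"
          using v(3) by (intro bexI[of _ "\<phi> w"]) auto
      qed
    qed
  qed
qed

text \<open>Deleting a vertex with fewer than \<open>card V\<close> neighbours destroys fewer than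
  \<open>2 * card V\<close> arcs, both orientations counted, so the inequality survives. It fails
  for empty \<open>X\<close>; hence the deletions stop at a nonempty set of minimum degree at least
  \<open>card V\<close>.\<close>

lemma forest_embeds_if_many_arcs:
  assumes "finite V" "one_degenerate V E" "sym E" "irrefl E" "sym R"
    and "finite X" "2 * card V * card X < card (R \<inter> X \<times> X)"
  shows "embeds V E X R"
  using assms(6,7)
proof (induction X rule: finite_psubset_induct)
  case (psubset X)
  show ?case
  proof (cases "\<exists>x\<in>X. card {y \<in> X. (x, y) \<in> R} < card V")
    case True
    then obtain x where x: "x \<in> X" "card {y \<in> X. (x, y) \<in> R} < card V" by blast
    let ?N = "{y \<in> X. (x, y) \<in> R}" and ?X = "X - {x}"
    have "R \<inter> X \<times> X \<subseteq> (R \<inter> ?X \<times> ?X) \<union> ({x} \<times> ?N \<union> ?N \<times> {x})"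
      using symD[OF assms(5)] by blast
    then have "card (R \<inter> X \<times> X) \<le> card ((R \<inter> ?X \<times> ?X) \<union> ({x} \<times> ?N \<union> ?N \<times> {x}))"
      using psubset.hyps(1) by (intro card_mono) auto
    also have "\<dots> \<le> card (R \<inter> ?X \<times> ?X) + (card ({x} \<times> ?N) + card (?N \<times> {x}))"
      by (meson card_Un_le order_trans add_left_mono)
    also have "\<dots> = card (R \<inter> ?X \<times> ?X) + 2 * card ?N"
      by (simp add: card_cartesian_product)
    finally have "card (R \<inter> X \<times> X) \<le> card (R \<inter> ?X \<times> ?X) + 2 * card ?N" .
    moreover have "2 * card V * card X = 2 * card V * card ?X + 2 * card V"
      using card.remove[OF psubset.hyps(1) x(1)] by (simp add: algebra_simps)
    ultimately have "2 * card V * card ?X < card (R \<inter> ?X \<times> ?X)"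
      using psubset.prems x(2) by linarith
    then have "embeds V E ?X R" using x(1) by (intro psubset.IH) auto
    then show ?thesis by (rule embeds_mono) blast
  next
    case False
    have "X \<noteq> {}" using psubset.prems by auto
    then show ?thesis
      using False psubset.hyps(1) by (intro forest_embeds_min_degree assms) (auto simp: not_less)
  qed
qed

section \<open>Copies as images of embeddings\<close>

definition image_graph :: "('a \<Rightarrow> 'b) \<Rightarrow> 'a pair_pre_digraph \<Rightarrow> 'b pair_pre_digraph" where
  "image_graph \<phi> H = \<lparr>pverts = \<phi> ` pverts H, parcs = (\<lambda>(u, v). (\<phi> u, \<phi> v)) ` parcs H\<rparr>"

lemma image_graph_cong:
  assumes "pair_graph H" "\<And>v. v \<in> pverts H \<Longrightarrow> \<phi> v = \<psi> v"
  shows "image_graph \<phi> H = image_graph \<psi> H"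
proof -
  interpret pair_graph H by fact
  have "(\<lambda>(u, v). (\<phi> u, \<phi> v)) ` parcs H = (\<lambda>(u, v). (\<psi> u, \<psi> v)) ` parcs H"
    using assms(2) in_arcsD1 in_arcsD2 by (intro image_cong) auto
  moreover have "\<phi> ` pverts H = \<psi> ` pverts H" using assms(2) by (intro image_cong) auto
  ultimately show ?thesis by (simp add: image_graph_def)
qed

definition embeddings :: "'a pair_pre_digraph \<Rightarrow> 'b pair_pre_digraph \<Rightarrow> ('a \<Rightarrow> 'b) set" where
  "embeddings H G = {\<phi> \<in> homs (pverts H) (parcs H) (\<lambda>_. pverts G) (parcs G). inj_on \<phi> (pverts H)}"

lemma digraph_iso_image_graph:
  assumes "pair_graph H" "inj_on \<phi> (pverts H)"
  shows "digraph_iso (with_proj H) (with_proj (image_graph \<phi> H))"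
proof -
  interpret pair_graph H by fact
  let ?f = "\<lparr>iso_verts = \<phi>, iso_arcs = (\<lambda>(u, v). (\<phi> u, \<phi> v)), iso_head = snd, iso_tail = fst\<rparr>"
  have "inj_on (\<lambda>(u, v). (\<phi> u, \<phi> v)) (parcs H)"
    using assms(2) in_arcsD1 in_arcsD2 by (auto simp: inj_on_def)
  then have "pre_digraph.digraph_isomorphism (with_proj H) ?f"
    unfolding pre_digraph.digraph_isomorphism_def using assms(2) wf_digraph_axioms
    by (auto simp: case_prod_beta)
  moreover have "with_proj (image_graph \<phi> H) = app_iso ?f (with_proj H)"
    by (simp add: app_iso_def image_graph_def with_proj_def)
  ultimately show ?thesis unfolding digraph_iso_def by blast
qed

text \<open>An isomorphism onto a copy, restricted to the vertices, is an embedding, and conversely.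
  Hence copies are at most as numerous as embeddings, and freeness is the absence of
  embeddings.\<close>

lemma copies_eq_image_embeddings:
  assumes H: "pair_graph H" and G: "pair_graph G"
  shows "copies H G = (\<lambda>\<phi>. image_graph \<phi> H) ` embeddings H G"
proof (intro equalityI subsetI)
  interpret H: pair_graph H by fact
  interpret G: pair_graph G by fact
  fix S assume "S \<in> copies H G"
  then have sub: "subgraph (with_proj S) (with_proj G)"
    and iso: "digraph_iso (with_proj H) (with_proj S)" by (auto simp: copies_def)
  obtain f where f: "pre_digraph.digraph_isomorphism (with_proj H) f" "with_proj S = app_iso f (with_proj H)"
    using iso unfolding digraph_iso_def by blast
  let ?g = "iso_verts f"
  have inj: "inj_on ?g (pverts H)"
    using f(1) by (simp add: H.digraph_isomorphism_def)
  have V: "pverts S = ?g ` pverts H"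
    using arg_cong[OF f(2), of verts] by simp
  have t: "iso_tail f = fst" and h: "iso_head f = snd"
    using arg_cong[OF f(2), of tail] arg_cong[OF f(2), of head] by simp_all
  have arc: "iso_arcs f e = (\<lambda>(u, v). (?g u, ?g v)) e" if "e \<in> parcs H" for e
    using f(1) that unfolding H.digraph_isomorphism_def by (auto simp: t h prod_eq_iff case_prod_beta)
  have "parcs S = iso_arcs f ` parcs H"
    using arg_cong[OF f(2), of arcs] by simp
  also have "\<dots> = (\<lambda>(u, v). (?g u, ?g v)) ` parcs H"
    using arc by (rule image_cong[OF refl])
  finally have S: "S = image_graph ?g H" using V by (simp add: image_graph_def)
  have sub': "pverts S \<subseteq> pverts G" "parcs S \<subseteq> parcs G" using sub by (auto simp: subgraph_def)
  let ?\<phi> = "restrict ?g (pverts H)"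
  have "?\<phi> \<in> embeddings H G"
    using inj sub' unfolding S embeddings_def homs_def image_graph_def by (auto simp: inj_on_def)
  moreover have "S = image_graph ?\<phi> H" unfolding S by (intro image_graph_cong H) simp
  ultimately show "S \<in> (\<lambda>\<phi>. image_graph \<phi> H) ` embeddings H G" by blast
next
  interpret H: pair_graph H by fact
  interpret G: pair_graph G by fact
  fix S assume "S \<in> (\<lambda>\<phi>. image_graph \<phi> H) ` embeddings H G"
  then obtain \<phi> where \<phi>: "\<phi> \<in> embeddings H G" and S: "S = image_graph \<phi> H" by blast
  have iso: "digraph_iso (with_proj H) (with_proj S)"
    unfolding S using \<phi> by (intro digraph_iso_image_graph H) (simp add: embeddings_def)
  interpret S: pair_graph S using digraph_iso_pair_graph[OF H iso] .
  have "pverts S \<subseteq> pverts G" "parcs S \<subseteq> parcs G"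
    using \<phi> H.in_arcsD1 H.in_arcsD2 unfolding S embeddings_def homs_def image_graph_def by auto
  then have "subgraph (with_proj S) (with_proj G)"
    using S.wf_digraph_axioms G.wf_digraph_axioms by (simp add: subgraph_def compatible_def)
  then show "S \<in> copies H G" using iso by (simp add: copies_def)
qed

lemma embeddings_nonempty_iff:
  "embeddings H G \<noteq> {} \<longleftrightarrow> embeds (pverts H) (parcs H) (pverts G) (parcs G)"
proof
  assume "embeddings H G \<noteq> {}"
  then show "embeds (pverts H) (parcs H) (pverts G) (parcs G)"
    unfolding embeddings_def homs_def embeds_def by blast
next
  assume "embeds (pverts H) (parcs H) (pverts G) (parcs G)"
  then obtain \<phi> where "inj_on \<phi> (pverts H)" "\<phi> ` pverts H \<subseteq> pverts G"
    "\<forall>u\<in>pverts H. \<forall>v\<in>pverts H. (u, v) \<in> parcs H \<longrightarrow> (\<phi> u, \<phi> v) \<in> parcs G"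
    unfolding embeds_def by blast
  then have "restrict \<phi> (pverts H) \<in> embeddings H G"
    unfolding embeddings_def homs_def by (auto simp: inj_on_def)
  then show "embeddings H G \<noteq> {}" by blast
qed

lemma family_free_iff:
  assumes "\<forall>F\<in>\<F>. pair_graph F" "pair_graph G"
  shows "family_free \<F> G \<longleftrightarrow> (\<forall>F\<in>\<F>. \<not> embeds (pverts F) (parcs F) (pverts G) (parcs G))"
  using assms by (simp add: family_free_def copies_eq_image_embeddings flip: embeddings_nonempty_iff)

lemma finite_embeddings:
  assumes "pair_graph H" "pair_graph G"
  shows "finite (embeddings H G)"
proof -
  interpret H: pair_graph H by fact
  interpret G: pair_graph G by fact
  show ?thesis unfolding embeddings_def
    using H.pair_finite_verts G.pair_finite_verts by (simp add: finite_homs)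
qed

lemma card_copies_le_card_embeddings:
  assumes "pair_graph H" "pair_graph G"
  shows "card (copies H G) \<le> card (embeddings H G)"
  unfolding copies_eq_image_embeddings[OF assms]
  by (rule card_image_le[OF finite_embeddings[OF assms]])

subsection \<open>From many copies to a blow-up\<close>

text \<open>Averaging over all maps from \<open>X\<close> to \<open>V\<close>: with
  \<open>h = card V\<close>, each \<open>\<phi>\<close> is compatible with the fraction
  \<open>1 / h ^ h\<close> of them. With the colour classes as parts, a host becomes partite at the
  cost of a constant factor.\<close>

lemma exists_compatible_colouring:
  assumes "finite V" "finite X" "finite I" "I \<noteq> {}"
    and I: "\<And>\<phi>. \<phi> \<in> I \<Longrightarrow> inj_on \<phi> V \<and> \<phi> ` V \<subseteq> X"
  obtains \<chi> where "card I \<le> card V ^ card V * card {\<phi> \<in> I. \<forall>v\<in>V. \<chi> (\<phi> v) = v}"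
proof -
  let ?h = "card V" and ?K = "Pi\<^sub>E X (\<lambda>_. V)"
  have finK: "finite ?K" using assms by (intro finite_PiE) auto
  have count: "?h ^ ?h * card {\<chi> \<in> ?K. \<forall>v\<in>V. \<chi> (\<phi> v) = v} = ?h ^ card X" if "\<phi> \<in> I" for \<phi>
  proof -
    note \<phi> = I[OF that]
    have sub: "\<phi> ` V \<subseteq> X" and card: "card (\<phi> ` V) = ?h" using \<phi> by (auto simp: card_image)
    let ?B = "\<lambda>x. if x \<in> \<phi> ` V then {the_inv_into V \<phi> x} else V"
    \<comment> \<open>Compatibility forces the colours on the image of \<open>\<phi>\<close> and
      leaves all others free.\<close>
    have "{\<chi> \<in> ?K. \<forall>v\<in>V. \<chi> (\<phi> v) = v} = Pi\<^sub>E X ?B"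
    proof (intro equalityI subsetI)
      fix \<chi> assume "\<chi> \<in> {\<chi> \<in> ?K. \<forall>v\<in>V. \<chi> (\<phi> v) = v}"
      then show "\<chi> \<in> Pi\<^sub>E X ?B" using \<phi> by (auto simp: PiE_iff the_inv_into_f_f)
    next
      fix \<chi> assume \<chi>: "\<chi> \<in> Pi\<^sub>E X ?B"
      have "\<chi> x \<in> V" if "x \<in> X" for x
        using PiE_mem[OF \<chi> that] \<phi> by (auto simp: the_inv_into_f_f split: if_splits)
      moreover have "\<chi> (\<phi> v) = v" if "v \<in> V" for v
        using PiE_mem[OF \<chi>, of "\<phi> v"] \<phi> that by (auto simp: the_inv_into_f_f)
      ultimately show "\<chi> \<in> {\<chi> \<in> ?K. \<forall>v\<in>V. \<chi> (\<phi> v) = v}"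
        using \<chi> by (auto simp: PiE_iff)
    qed
    then have "card {\<chi> \<in> ?K. \<forall>v\<in>V. \<chi> (\<phi> v) = v} = (\<Prod>x\<in>X. card (?B x))"
      using assms(2) by (simp add: card_PiE)
    also have "\<dots> = (\<Prod>x\<in>X - \<phi> ` V. ?h)"
      using assms(2) by (intro prod.mono_neutral_cong_right) auto
    also have "\<dots> = ?h ^ (card X - ?h)"
      using card_Diff_subset[OF finite_subset[OF sub assms(2)] sub] card by simp
    finally show ?thesis
      using card_mono[OF assms(2) sub] card by (simp flip: power_add)
  qed
  show thesis
  proof (rule ccontr)
    assume no: "\<not> thesis"
    have less: "?h ^ ?h * card {\<phi> \<in> I. \<forall>v\<in>V. \<chi> (\<phi> v) = v} < card I" for \<chi>
      using that[of \<chi>] no by (meson not_le)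
    obtain \<phi> where "\<phi> \<in> I" using assms(4) by blast
    have "card V \<noteq> 0 \<or> V = {}" using assms(1) by auto
    then have "0 < card ?K \<or> (V = {} \<and> X \<noteq> {})" using assms(1,2) by (auto simp: card_PiE)
    \<comment> \<open>For empty \<open>V\<close> every map is compatible and
      \<open>0 ^ 0 = 1\<close>, so the bound would hold for any \<open>\<chi>\<close>.\<close>
    moreover have "V \<noteq> {}"
    proof
      assume V: "V = {}"
      then have "{\<phi> \<in> I. \<forall>v\<in>V. \<chi> (\<phi> v) = v} = I" for \<chi> by blast
      then show False using less[of undefined] V by simp
    qed
    ultimately have "?K \<noteq> {}" by force
    \<comment> \<open>Double counting of compatible pairs: the strict bounds summed over all
      colourings contradict the exact value from \<open>count\<close>.\<close>
    have "(\<Sum>\<chi>\<in>?K. ?h ^ ?h * card {\<phi> \<in> I. \<forall>v\<in>V. \<chi> (\<phi> v) = v}) < (\<Sum>\<chi>\<in>?K. card I)"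
      using less finK \<open>?K \<noteq> {}\<close> by (intro sum_strict_mono) auto
    moreover have "(\<Sum>\<chi>\<in>?K. ?h ^ ?h * card {\<phi> \<in> I. \<forall>v\<in>V. \<chi> (\<phi> v) = v}) =
        (\<Sum>\<phi>\<in>I. ?h ^ ?h * card {\<chi> \<in> ?K. \<forall>v\<in>V. \<chi> (\<phi> v) = v})"
      unfolding sum_distrib_left[symmetric]
      using sum.swap_restrict[OF finK assms(3), of "\<lambda>_ _. 1::nat" "\<lambda>\<chi> \<phi>. \<forall>v\<in>V. \<chi> (\<phi> v) = v"]
      by simp
    moreover have "\<dots> = (\<Sum>\<phi>\<in>I. ?h ^ card X)" using count by (rule sum.cong[OF refl])
    moreover have "(\<Sum>\<chi>\<in>?K. card I) = card I * ?h ^ card X"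
      using assms(2) by (simp add: card_PiE mult.commute)
    ultimately show False by simp
  qed
qed

section \<open>Blow-ups as graphs\<close>

definition blow_verts :: "'a set \<Rightarrow> ('a \<Rightarrow> nat) \<Rightarrow> nat \<Rightarrow> ('a \<times> nat) set" where
  "blow_verts V \<kappa> m = {(v, j). v \<in> V \<and> j < m \<and> (\<kappa> v = 0 \<longrightarrow> j = 0)}"

text \<open>Indices have to agree only between two vertices of nonzero label. Vertices of label 0
  occur with index 0 alone in \<open>blow_verts\<close> and are joined to every copy of their
  neighbours.\<close>

definition blow_arcs :: "'a rel \<Rightarrow> ('a \<Rightarrow> nat) \<Rightarrow> ('a \<times> nat) rel" where
  "blow_arcs E \<kappa> = {((u, i), (v, j)). (u, v) \<in> E \<and> (\<kappa> u \<noteq> 0 \<longrightarrow> \<kappa> v \<noteq> 0 \<longrightarrow> i = j)}"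

lemma finite_blow_verts: "finite V \<Longrightarrow> finite (blow_verts V \<kappa> m)"
  by (rule finite_subset[of _ "V \<times> {..<m}"]) (auto simp: blow_verts_def)

lemma card_blow_verts_le: "finite V \<Longrightarrow> card (blow_verts V \<kappa> m) \<le> card V * m"
  using card_mono[of "V \<times> {..<m}" "blow_verts V \<kappa> m"]
  by (auto simp: blow_verts_def card_cartesian_product)

lemma le_card_blow_verts:
  assumes "finite V" "v \<in> V" "\<kappa> v \<noteq> 0"
  shows "m \<le> card (blow_verts V \<kappa> m)"
proof -
  have "card ({v} \<times> {..<m}) \<le> card (blow_verts V \<kappa> m)"
    using assms by (intro card_mono finite_blow_verts) (auto simp: blow_verts_def)
  then show ?thesis by (simp add: card_cartesian_product)
qed

lemma blow_verts_mono: "m \<le> n \<Longrightarrow> blow_verts V \<kappa> m \<subseteq> blow_verts V \<kappa> n"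
  unfolding blow_verts_def by auto

lemma sym_blow_arcs: "sym E \<Longrightarrow> sym (blow_arcs E \<kappa>)"
  unfolding blow_arcs_def sym_def by auto

lemma irrefl_blow_arcs: "irrefl E \<Longrightarrow> irrefl (blow_arcs E \<kappa>)"
  unfolding blow_arcs_def irrefl_def by auto

text \<open>
  A graph on at most \<^term>\<open>t\<close> vertices meets at most \<^term>\<open>t\<close> copies of each class, so only
  \<^term>\<open>t\<close> copies are ever needed.
\<close>

lemma embeds_via_blow_up_map:
  assumes F: "finite W" "card W \<le> t" "embeds W D (blow_verts V \<kappa> m) (blow_arcs E \<kappa>)"
    and \<Phi>: "blow_up_map t V E A R \<kappa> \<Phi>"
    and disj: "\<And>u v. u \<in> V \<Longrightarrow> v \<in> V \<Longrightarrow> u \<noteq> v \<Longrightarrow> A u \<inter> A v = {}"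
    and A: "\<And>v. v \<in> V \<Longrightarrow> A v \<subseteq> X"
  shows "embeds W D X R"
proof -
  obtain \<phi> where \<phi>: "inj_on \<phi> W" "\<phi> ` W \<subseteq> blow_verts V \<kappa> m"
    "\<forall>u\<in>W. \<forall>v\<in>W. (u, v) \<in> D \<longrightarrow> (\<phi> u, \<phi> v) \<in> blow_arcs E \<kappa>"
    using F(3) unfolding embeds_def by blast
  define J where "J = (snd \<circ> \<phi>) ` W"
  have "finite J" "card J \<le> t"
    using F(1,2) card_image_le[OF F(1), of "snd \<circ> \<phi>"] by (auto simp: J_def)
  \<comment> \<open>One renumbering serves all classes, so equal indices stay equal and distinct
    ones distinct.\<close>
  then obtain g where g: "inj_on g J" "g ` J \<subseteq> {..<t}"
    by (metis card_le_inj card_lessThan finite_lessThan)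
  have V: "fst (\<phi> x) \<in> V" and gt: "g (snd (\<phi> x)) < t" and J: "snd (\<phi> x) \<in> J" if "x \<in> W" for x
  proof -
    show "fst (\<phi> x) \<in> V" using \<phi>(2) that by (auto simp: blow_verts_def)
    show J: "snd (\<phi> x) \<in> J" using that by (auto simp: J_def)
    show "g (snd (\<phi> x)) < t" using g(2) J by auto
  qed
  let ?\<psi> = "\<lambda>x. \<Phi> (fst (\<phi> x)) (g (snd (\<phi> x)))"
  have inA: "?\<psi> x \<in> A (fst (\<phi> x))" if "x \<in> W" for x
    by (rule blow_up_mapD(1)[OF \<Phi> V[OF that] gt[OF that]])
  have "inj_on ?\<psi> W"
  proof (rule inj_onI)
    fix x y assume xy: "x \<in> W" "y \<in> W" "?\<psi> x = ?\<psi> y"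
    have fst: "fst (\<phi> x) = fst (\<phi> y)"
    proof (rule ccontr)
      assume "fst (\<phi> x) \<noteq> fst (\<phi> y)"
      then have "A (fst (\<phi> x)) \<inter> A (fst (\<phi> y)) = {}" using V xy by (intro disj) auto
      then show False using inA[OF xy(1)] inA[OF xy(2)] xy(3) by auto
    qed
    have "snd (\<phi> x) = snd (\<phi> y)"
    proof (cases "\<kappa> (fst (\<phi> x)) = 0")
      case True
      have "\<phi> x \<in> blow_verts V \<kappa> m" "\<phi> y \<in> blow_verts V \<kappa> m" using \<phi>(2) xy by auto
      then show ?thesis using True fst by (auto simp: blow_verts_def)
    next
      case False
      have "inj_on (\<Phi> (fst (\<phi> x))) {..<t}" by (rule blow_up_mapD(3)[OF \<Phi> V[OF xy(1)] False])
      moreover have "\<Phi> (fst (\<phi> x)) (g (snd (\<phi> x))) = \<Phi> (fst (\<phi> x)) (g (snd (\<phi> y)))"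
        using xy(3) by (simp add: fst)
      ultimately have "g (snd (\<phi> x)) = g (snd (\<phi> y))"
        by (rule inj_onD) (use gt xy in auto)
      then show ?thesis by (rule inj_onD[OF g(1)]) (use J xy in auto)
    qed
    then have "\<phi> x = \<phi> y" using fst by (simp add: prod_eq_iff)
    then show "x = y" using \<phi>(1) xy by (meson inj_onD)
  qed
  moreover have "?\<psi> ` W \<subseteq> X" using inA V A by blast
  moreover have "(?\<psi> x, ?\<psi> y) \<in> R" if xy: "x \<in> W" "y \<in> W" "(x, y) \<in> D" for x y
  proof -
    let ?u = "fst (\<phi> x)" and ?v = "fst (\<phi> y)" and ?i = "g (snd (\<phi> x))" and ?j = "g (snd (\<phi> y))"
    have "(\<phi> x, \<phi> y) \<in> blow_arcs E \<kappa>" using \<phi>(3) xy by blast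
    then have E: "(?u, ?v) \<in> E" and eq: "\<kappa> ?u \<noteq> 0 \<Longrightarrow> \<kappa> ?v \<noteq> 0 \<Longrightarrow> ?i = ?j"
      by (auto simp: blow_arcs_def)
    have R: "(\<Phi> ?u k, \<Phi> ?v k) \<in> R" if "k < t" for k
      by (rule blow_up_mapD(4)[OF \<Phi> V[OF xy(2)] V[OF xy(1)] that E])
    \<comment> \<open>If the indices differ, one end has label 0, and its image is the same in all
      copies.\<close>
    consider "?i = ?j" | "\<kappa> ?u = 0" | "\<kappa> ?v = 0" using eq by blast
    then show ?thesis
    proof cases
      case 1
      then show ?thesis using R[OF gt[OF xy(1)]] by simp
    next
      case 2
      then have "\<Phi> ?u ?i = \<Phi> ?u ?j"
        using blow_up_mapD(2)[OF \<Phi> V[OF xy(1)]] gt xy by blast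
      then show ?thesis using R[OF gt[OF xy(2)]] by simp
    next
      case 3
      then have "\<Phi> ?v ?j = \<Phi> ?v ?i"
        using blow_up_mapD(2)[OF \<Phi> V[OF xy(2)]] gt xy by blast
      then show ?thesis using R[OF gt[OF xy(1)]] by simp
    qed
  qed
  ultimately show ?thesis unfolding embeds_def by (intro exI[of _ ?\<psi>]) blast
qed

lemma pair_graph_sym_irrefl:
  assumes "pair_graph G"
  shows "sym (parcs G)" "irrefl (parcs G)"
proof -
  interpret pair_graph G by fact
  show "sym (parcs G)" using pair_sym_arcs by (simp add: symmetric_def)
  show "irrefl (parcs G)" using pair_no_loops unfolding irrefl_def by force
qed

text \<open>A colouring makes the host partite and keeps a fixed fraction of the embeddings, so the
  threshold for partite homomorphisms applies. The conclusion transfers every small graph from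
  blow-ups with labels \<open>\<kappa>\<close>, for any number \<open>m\<close> of copies, to the
  host.\<close>

lemma many_embeddings_imp_blow_up:
  fixes T :: "'a pair_pre_digraph"
  assumes T: "pair_graph T" "one_degenerate (pverts T) (parcs T)" and "0 < t"
  shows "\<exists>C. \<forall>G :: 'b pair_pre_digraph. pair_graph G \<longrightarrow>
      card (parcs G) \<le> d * card (pverts G) \<longrightarrow>
      C * card (pverts G) ^ q < card (pverts G) * card (embeddings T G) \<longrightarrow>
      (\<exists>\<kappa>. labelling q (pverts T) (parcs T) \<kappa> \<and>
        (\<forall>(W :: nat set) D m. finite W \<longrightarrow> card W \<le> t \<longrightarrow>
          embeds W D (blow_verts (pverts T) \<kappa> m) (blow_arcs (parcs T) \<kappa>) \<longrightarrow>
          embeds W D (pverts G) (parcs G)))"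
proof -
  interpret T: pair_graph T by fact
  let ?V = "pverts T" and ?E = "parcs T"
  note E = pair_graph_sym_irrefl[OF T(1)]
  obtain C where C: "blow_up_bound d q t ?V ?E TYPE('b) C"
    using blow_up_bound_exists[OF T.pair_finite_verts T(2) E \<open>0 < t\<close>] by blast
  let ?c = "card ?V ^ card ?V"
  show ?thesis
  proof (intro exI[of _ "?c * C"] allI impI)
    fix G :: "'b pair_pre_digraph"
    assume G: "pair_graph G" "card (parcs G) \<le> d * card (pverts G)"
      and many: "?c * C * card (pverts G) ^ q < card (pverts G) * card (embeddings T G)"
    interpret G: pair_graph G by fact
    let ?n = "card (pverts G)"
    have fin: "finite (embeddings T G)" by (rule finite_embeddings[OF T(1) G(1)])
    have ne: "embeddings T G \<noteq> {}" using many by (intro notI) simp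
    obtain \<chi> where \<chi>: "card (embeddings T G) \<le> ?c * card {\<phi> \<in> embeddings T G. \<forall>v\<in>?V. \<chi> (\<phi> v) = v}"
    proof (rule exists_compatible_colouring[OF T.pair_finite_verts G.pair_finite_verts fin ne])
      show "inj_on \<phi> ?V \<and> \<phi> ` ?V \<subseteq> pverts G" if "\<phi> \<in> embeddings T G" for \<phi>
        using that by (auto simp: embeddings_def homs_def)
    qed
    define A where "A v = {x \<in> pverts G. \<chi> x = v}" for v
    note symR = pair_graph_sym_irrefl(1)[OF G(1)]
    have "card {\<phi> \<in> embeddings T G. \<forall>v\<in>?V. \<chi> (\<phi> v) = v} \<le> card (homs ?V ?E A (parcs G))"
    proof (rule card_mono)
      show "finite (homs ?V ?E A (parcs G))"
        using T.pair_finite_verts G.pair_finite_verts by (intro finite_homs) (auto simp: A_def)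
      show "{\<phi> \<in> embeddings T G. \<forall>v\<in>?V. \<chi> (\<phi> v) = v} \<subseteq> homs ?V ?E A (parcs G)"
        by (auto simp: embeddings_def homs_def A_def PiE_iff)
    qed
    then have le: "card (embeddings T G) \<le> ?c * card (homs ?V ?E A (parcs G))"
      using \<chi> by (meson mult_le_mono2 order_trans)
    have "?c * (C * ?n ^ q) < ?n * card (embeddings T G)" using many by (simp only: mult.assoc)
    also have "\<dots> \<le> ?n * (?c * card (homs ?V ?E A (parcs G)))" using le by (rule mult_le_mono2)
    also have "\<dots> = ?c * (?n * card (homs ?V ?E A (parcs G)))" by (simp only: mult.left_commute)
    finally have "?c * (C * ?n ^ q) < ?c * (?n * card (homs ?V ?E A (parcs G)))" .
    then have "C * ?n ^ q < ?n * card (homs ?V ?E A (parcs G))"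
      by (meson mult_less_cancel1)
    then have "contains_blow_up q t ?V ?E A (parcs G)"
    proof (rule blow_up_boundD[OF C symR, rotated -1])
      show "finite (A v)" for v using G.pair_finite_verts by (simp add: A_def)
      show "card (A v) \<le> ?n" for v
        using G.pair_finite_verts by (intro card_mono) (auto simp: A_def)
      show "card (parcs G \<inter> A u \<times> A v) \<le> d * ?n" for u v
        using card_mono[OF G.pair_finite_arcs, of "parcs G \<inter> A u \<times> A v"] G(2) by simp
    qed
    then obtain \<kappa> \<Phi> where "labelling q ?V ?E \<kappa>" "blow_up_map t ?V ?E A (parcs G) \<kappa> \<Phi>"
      unfolding contains_blow_up_def by blast
    moreover have "A u \<inter> A v = {}" if "u \<noteq> v" for u v using that by (auto simp: A_def)
    moreover have "A v \<subseteq> pverts G" for v by (auto simp: A_def)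
    ultimately show "\<exists>\<kappa>. labelling q ?V ?E \<kappa> \<and>
        (\<forall>(W :: nat set) D m. finite W \<longrightarrow> card W \<le> t \<longrightarrow>
          embeds W D (blow_verts ?V \<kappa> m) (blow_arcs ?E \<kappa>) \<longrightarrow>
          embeds W D (pverts G) (parcs G))"
      by (meson embeds_via_blow_up_map)
  qed
qed

subsection \<open>Copies in blow-ups and growth rates\<close>

lemma pair_graph_image_graph:
  assumes "pair_graph H" "inj_on \<phi> (pverts H)"
  shows "pair_graph (image_graph \<phi> H)"
  using digraph_iso_pair_graph[OF assms(1) digraph_iso_image_graph[OF assms]] .

lemma image_graph_embeds:
  assumes "pair_graph H" "inj_on \<phi> (pverts H)"
  shows "embeds (pverts (image_graph \<phi> H)) (parcs (image_graph \<phi> H)) (pverts H) (parcs H)"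
  unfolding embeds_def
proof (intro exI[of _ "the_inv_into (pverts H) \<phi>"] conjI ballI impI)
  interpret pair_graph H by fact
  show "inj_on (the_inv_into (pverts H) \<phi>) (pverts (image_graph \<phi> H))"
    using inj_on_the_inv_into[OF assms(2)] by (simp add: image_graph_def)
  show "the_inv_into (pverts H) \<phi> ` pverts (image_graph \<phi> H) \<subseteq> pverts H"
    using assms(2) by (auto simp: image_graph_def the_inv_into_f_f)
  fix x y assume "(x, y) \<in> parcs (image_graph \<phi> H)"
  then obtain u v where "(u, v) \<in> parcs H" "x = \<phi> u" "y = \<phi> v" by (auto simp: image_graph_def)
  then show "(the_inv_into (pverts H) \<phi> x, the_inv_into (pverts H) \<phi> y) \<in> parcs H"
    using in_arcsD1[of u v] in_arcsD2[of u v] by (simp add: the_inv_into_f_f[OF assms(2)])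
qed

text \<open>
  The host has exactly \<^term>\<open>n\<close> vertices because it is cut out of a larger blow-up; padding with
  isolated vertices could create forbidden graphs having isolated vertices.
\<close>

lemma blow_up_le_ex_num:
  fixes T :: "'a pair_pre_digraph"
  assumes T: "pair_graph T" and \<kappa>: "labelling q (pverts T) (parcs T) \<kappa>" "0 < q"
    and \<F>: "\<forall>F\<in>\<F>. pair_graph F"
    and free: "\<And>F m. F \<in> \<F> \<Longrightarrow>
      \<not> embeds (pverts F) (parcs F) (blow_verts (pverts T) \<kappa> m) (blow_arcs (parcs T) \<kappa>)"
  shows "m ^ q \<le> ex_num (card (pverts T) * m) T \<F>"
proof -
  interpret T: pair_graph T by fact
  let ?V = "pverts T" and ?E = "parcs T" and ?n = "card (pverts T) * m"
  note E = pair_graph_sym_irrefl[OF T]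
  have hit: "\<exists>v\<in>?V. \<kappa> v = i" if "i \<in> {1..q}" for i
    using labellingD(2)[OF \<kappa>(1)] that by blast
  have lab: "\<kappa> v \<in> {1..q}" if "v \<in> ?V" "\<kappa> v \<noteq> 0" for v
    using labellingD(1)[OF \<kappa>(1) that(1)] that(2) by simp
  obtain v where v: "v \<in> ?V" "\<kappa> v \<noteq> 0" using hit[of 1] \<kappa>(2) by auto
  have "m \<le> ?n" using v(1) T.pair_finite_verts by (cases "card ?V") auto
  \<comment> \<open>The blow-up with \<open>m\<close> copies has at most \<open>?n\<close> vertices
    and the one with \<open>?n\<close> copies at least \<open>?n\<close>, as some vertex has nonzero
    label; a set of exactly \<open>?n\<close> vertices fits in between.\<close>
  obtain X where X: "blow_verts ?V \<kappa> m \<subseteq> X" "X \<subseteq> blow_verts ?V \<kappa> ?n" "card X = ?n"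
    using exists_subset_between[OF card_blow_verts_le[OF T.pair_finite_verts, of \<kappa> m]
        le_card_blow_verts[of ?V v \<kappa> ?n, OF T.pair_finite_verts v]
        blow_verts_mono[OF \<open>m \<le> ?n\<close>] finite_blow_verts[OF T.pair_finite_verts]] by blast
  have finX: "finite X" using X(2) finite_blow_verts[OF T.pair_finite_verts] by (rule finite_subset)
  obtain e :: "'a \<times> nat \<Rightarrow> nat" where e: "inj_on e X"
    using finite_imp_inj_to_nat_seg[OF finX] by blast
  define B where "B = \<lparr>pverts = X, parcs = blow_arcs ?E \<kappa> \<inter> X \<times> X\<rparr>"
  have B: "pair_graph B"
  proof
    show "finite (pverts B)" "finite (parcs B)" using finX by (auto simp: B_def)
    show "symmetric B"
      using symD[OF sym_blow_arcs[OF E(1), of \<kappa>]] by (auto simp: symmetric_def B_def intro!: symI)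
    fix a assume "a \<in> parcs B"
    then show "fst a \<in> pverts B" "snd a \<in> pverts B" "fst a \<noteq> snd a"
      using irrefl_blow_arcs[OF E(2), of \<kappa>] by (auto simp: B_def irrefl_def)
  qed
  let ?G = "image_graph e B"
  have eB: "inj_on e (pverts B)" using e by (simp add: B_def)
  have G: "pair_graph ?G" by (rule pair_graph_image_graph[OF B eB])
  have cardG: "card (pverts ?G) = ?n" using e X(3) by (simp add: image_graph_def B_def card_image)
  have BU: "embeds (pverts B) (parcs B) (blow_verts ?V \<kappa> ?n) (blow_arcs ?E \<kappa>)"
    unfolding embeds_def using X(2) by (intro exI[of _ id]) (auto simp: B_def)
  have "family_free \<F> ?G"
    unfolding family_free_iff[OF \<F> G]
    using free embeds_trans[OF embeds_trans[OF _ image_graph_embeds[OF B eB]] BU] by blast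
  then have mem: "card (copies T ?G) \<in> copy_counts ?n T \<F>"
    unfolding copy_counts_def using G cardG by blast
  \<comment> \<open>Each class chooses its copy independently, since no edge joins different
    classes. A choice \<open>j\<close> yields a copy of \<open>T\<close>, which gives
    \<open>m ^ q\<close> copies.\<close>
  let ?J = "Pi\<^sub>E {1..q} (\<lambda>_. {..<m})"
  define pos where "pos j v = (v, if \<kappa> v = 0 then 0 else j (\<kappa> v))" for j :: "nat \<Rightarrow> nat" and v :: 'a
  have pos: "pos j v \<in> X" if "j \<in> ?J" "v \<in> ?V" for j v
  proof -
    have "0 < m" using PiE_mem[OF that(1), of 1] \<kappa>(2) by auto
    moreover have "j (\<kappa> v) < m" if "\<kappa> v \<noteq> 0"
      using PiE_mem[OF \<open>j \<in> ?J\<close> lab[OF \<open>v \<in> ?V\<close> that]] by simp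
    ultimately have "pos j v \<in> blow_verts ?V \<kappa> m" using that(2) by (auto simp: pos_def blow_verts_def)
    then show ?thesis using X(1) by blast
  qed
  have arc: "(pos j u, pos j v) \<in> blow_arcs ?E \<kappa>" if "u \<in> ?V" "v \<in> ?V" "(u, v) \<in> ?E" for j u v
  proof -
    have "\<kappa> u = \<kappa> v \<or> \<kappa> u = 0 \<or> \<kappa> v = 0" using labellingD(3)[OF \<kappa>(1) that] .
    then show ?thesis using that(3) by (auto simp: pos_def blow_arcs_def)
  qed
  define f where "f j = image_graph (restrict (\<lambda>v. e (pos j v)) ?V) T" for j
  have "f j \<in> copies T ?G" if j: "j \<in> ?J" for j
  proof -
    have "inj_on (\<lambda>v. e (pos j v)) ?V"
    proof (rule inj_onI)
      fix u v assume "u \<in> ?V" "v \<in> ?V" "e (pos j u) = e (pos j v)"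
      then have "pos j u = pos j v" using inj_onD[OF e] pos[OF j] by blast
      then show "u = v" by (simp add: pos_def)
    qed
    moreover have "(e (pos j u), e (pos j v)) \<in> parcs ?G" if "u \<in> ?V" "v \<in> ?V" "(u, v) \<in> ?E" for u v
    proof -
      have "(pos j u, pos j v) \<in> parcs B" using arc[OF that, of j] pos[OF j] that by (simp add: B_def)
      then show ?thesis unfolding image_graph_def by force
    qed
    moreover have "e (pos j v) \<in> pverts ?G" if "v \<in> ?V" for v
      using pos[OF j that] by (simp add: image_graph_def B_def)
    ultimately have "restrict (\<lambda>v. e (pos j v)) ?V \<in> embeddings T ?G"
      unfolding embeddings_def homs_def by (auto simp: inj_on_def)
    then show ?thesis unfolding copies_eq_image_embeddings[OF T G] f_def by blast
  qed
  \<comment> \<open>The vertex set of a copy determines \<open>j\<close>: a vertex of label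
    \<open>i\<close> occurs in it with index \<open>j i\<close> only.\<close>
  moreover have "inj_on f ?J"
  proof (rule inj_onI)
    fix j k assume jk: "j \<in> ?J" "k \<in> ?J" "f j = f k"
    have "pverts (f i) = (\<lambda>v. e (pos i v)) ` ?V" for i
      unfolding f_def image_graph_def by (simp add: restrict_def cong: image_cong)
    then have im: "(\<lambda>v. e (pos j v)) ` ?V = (\<lambda>v. e (pos k v)) ` ?V" using jk(3) by metis
    show "j = k"
    proof (rule PiE_ext[OF jk(1,2)])
      fix i assume i: "i \<in> {1..q}"
      then obtain v where v: "v \<in> ?V" "\<kappa> v = i" using hit by blast
      then have "e (pos j v) \<in> (\<lambda>v. e (pos k v)) ` ?V" using im by blast
      then obtain u where u: "u \<in> ?V" "e (pos j v) = e (pos k u)" by blast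
      then have "pos j v = pos k u" using inj_onD[OF e] pos jk v by blast
      then show "j i = k i" using v i by (auto simp: pos_def)
    qed
  qed
  ultimately have "card ?J \<le> card (copies T ?G)"
    using card_copies_le(1)[OF G] by (intro card_inj_on_le[of f]) auto
  also have "\<dots> \<le> Max (copy_counts ?n T \<F>)"
    by (rule Max_ge[OF finite_copy_counts mem])
  also have "\<dots> = ex_num ?n T \<F>" using mem unfolding ex_num_def by auto
  finally show ?thesis by (simp add: card_PiE)
qed

section \<open>Comparison of polynomial growth rates\<close>

lemma filterlim_nat_powr_at_top:
  assumes "0 < a"
  shows "filterlim (\<lambda>n. real n powr a) at_top sequentially"
  unfolding filterlim_at_top_dense
proof
  fix z :: real
  let ?x = "(\<bar>z\<bar> + 1) powr (1 / a)"
  have "\<forall>\<^sub>F n in sequentially. ?x < real n"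
    using filterlim_real_sequentially unfolding filterlim_at_top_dense by blast
  then show "\<forall>\<^sub>F n in sequentially. z < real n powr a"
  proof eventually_elim
    case (elim n)
    have "z < ?x powr a" using assms by (simp add: powr_powr)
    also have "\<dots> < real n powr a" using elim assms by (intro powr_less_mono2) auto
    finally show ?case .
  qed
qed

text \<open>Along the multiples \<open>h * m\<close>, the lower bound \<open>m ^ q\<close> outgrows
  every constant times \<open>(h * m) powr r\<close>.\<close>

lemma not_bigo_if_power_le:
  fixes f :: "nat \<Rightarrow> nat"
  assumes "(\<lambda>n. real (f n)) \<in> O(\<lambda>n. real n powr r)" "0 < h" "r < real q"
    and le: "\<And>m. m ^ q \<le> f (h * m)"
  shows False
proof -
  obtain c where "\<forall>\<^sub>F n in sequentially. norm (real (f n)) \<le> c * norm (real n powr r)"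
    using assms(1) by (elim landau_o.bigE)
  then have ev: "\<forall>\<^sub>F n in sequentially. real (f n) \<le> c * real n powr r" by simp
  have "filterlim (\<lambda>m. h * m) at_top sequentially"
    using assms(2) by (intro filterlim_subseq) (simp add: strict_mono_def)
  from eventually_compose_filterlim[OF ev this]
  have "\<forall>\<^sub>F m in sequentially. real (f (h * m)) \<le> c * real (h * m) powr r" .
  moreover have "\<forall>\<^sub>F m in sequentially. c * real h powr r < real m powr (real q - r)"
    using filterlim_nat_powr_at_top[of "real q - r"] assms(3)
    unfolding filterlim_at_top_dense by simp
  ultimately have "\<forall>\<^sub>F m in sequentially. False"
    using eventually_gt_at_top[of 0]
  proof eventually_elim
    case (elim m)
    have "real m powr (real q - r) * real m powr r = real m ^ q"
      using elim(3) by (simp flip: powr_add add: powr_realpow)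
    also have "\<dots> \<le> real (f (h * m))" using le[of m] by (metis of_nat_le_iff of_nat_power)
    also have "\<dots> \<le> c * real (h * m) powr r" by (rule elim(1))
    also have "\<dots> = (c * real h powr r) * real m powr r" by (simp add: powr_mult)
    finally have "real m powr (real q - r) \<le> c * real h powr r" using elim(3) by simp
    then show ?case using elim(2) by linarith
  qed
  then show False by simp
qed

text \<open>As \<open>r > p\<close>, \<open>n powr r\<close> outgrows every multiple of
  \<open>n ^ p\<close>. The conclusion has the form of the threshold in \<open>blow_up_bound\<close>
  with \<open>q = Suc p\<close>.\<close>

lemma bigomega_imp_large:
  fixes f :: "nat \<Rightarrow> nat"
  assumes "(\<lambda>n. real (f n)) \<in> \<Omega>(\<lambda>n. real n powr r)" "real p < r"
  obtains n where "C * n ^ Suc p < n * f n"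
proof -
  obtain c where c: "c > 0" and omega: "\<forall>\<^sub>F n in sequentially. norm (real (f n)) \<ge> c * norm (real n powr r)"
    using assms(1) by (elim landau_omega.bigE)
  have "\<forall>\<^sub>F m in sequentially. real C / c < real m powr (r - real p)"
    using filterlim_nat_powr_at_top[of "r - real p"] assms(2)
    unfolding filterlim_at_top_dense by simp
  with omega have "\<forall>\<^sub>F n in sequentially. C * n ^ Suc p < n * f n"
    using eventually_gt_at_top[of 0]
  proof eventually_elim
    case (elim n)
    have "real C < c * real n powr (r - real p)" using elim(2) c by (simp add: field_simps)
    then have "real C * real n powr p < c * real n powr (r - real p) * real n powr p"
      using elim(3) by (intro mult_strict_right_mono) auto
    also have "\<dots> = c * real n powr r" by (simp flip: powr_add)
    also have "\<dots> \<le> real (f n)" using elim(1) by simp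
    finally have "real (C * n ^ p) < real (f n)" using elim(3) by (simp add: powr_realpow)
    then have "C * n ^ p < f n" by (simp only: of_nat_less_iff)
    then have "n * (C * n ^ p) < n * f n" using elim(3) by simp
    then show ?case by (simp add: mult.left_commute)
  qed
  then show thesis using that by (meson eventually_happens sequentially_bot)
qed

subsection \<open>Trees and their leaves\<close>

lemma vwalk_arcs_append_subset: "set (vwalk_arcs xs) \<subseteq> set (vwalk_arcs (xs @ ys))"
  by (induction xs rule: vwalk_arcs.induct) auto

lemma pcas_vwalk_arcs: "pcas x (vwalk_arcs (x # zs)) (last (x # zs))"
  by (induction zs arbitrary: x) auto

lemma pawalk_verts_vwalk_arcs: "pawalk_verts x (vwalk_arcs (x # zs)) = x # zs"
  by (induction zs arbitrary: x) auto

text \<open>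
  If all degrees within \<^term>\<open>X\<close> were at least 2, the first vertex of a longest path
  inside \<^term>\<open>X\<close> would have two neighbours on the path, which closes a cycle.
\<close>

lemma one_degenerate_if_acyclic:
  assumes T: "pair_graph T"
    and acyclic: "\<not> (\<exists>p. pre_digraph.cycle (with_proj T) p \<and> 3 \<le> length p)"
  shows "one_degenerate (pverts T) (parcs T)"
  unfolding one_degenerate_def
proof (intro allI impI, rule ccontr)
  interpret pair_graph T by fact
  note E = pair_graph_sym_irrefl[OF T]
  fix X assume X: "X \<subseteq> pverts T" "X \<noteq> {}"
    and "\<not> (\<exists>v\<in>X. card {u \<in> X. (v, u) \<in> parcs T} \<le> 1)"
  then have deg: "2 \<le> card {u \<in> X. (v, u) \<in> parcs T}" if "v \<in> X" for v
    using that by force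
  have finX: "finite X" using X(1) pair_finite_verts by (rule finite_subset)
  define P where "P xs \<longleftrightarrow> xs \<noteq> [] \<and> distinct xs \<and> set xs \<subseteq> X \<and> set (vwalk_arcs xs) \<subseteq> parcs T" for xs
  have "P xs \<longrightarrow> length xs \<le> card X" for xs
    using finX by (auto simp: P_def intro: card_mono simp flip: distinct_card)
  moreover obtain x0 where "x0 \<in> X" using X(2) by blast
  then have "P [x0]" by (simp add: P_def)
  ultimately obtain xs where xs: "P xs" and max: "\<And>ys. P ys \<Longrightarrow> length ys \<le> length xs"
    using ex_has_greatest_nat[of P "[x0]" length "Suc (card X)"] by (auto simp: le_imp_less_Suc)
  obtain x ys where xys: "xs = x # ys" using xs by (cases xs) (auto simp: P_def)
  let ?N = "{u \<in> X. (x, u) \<in> parcs T}"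
  have N: "?N \<subseteq> set ys"
  proof
    fix u assume u: "u \<in> ?N"
    then have "u \<noteq> x" using E(2) by (auto simp: irrefl_def)
    show "u \<in> set ys"
    proof (rule ccontr)
      assume "u \<notin> set ys"
      moreover have "(u, x) \<in> parcs T" using u symD[OF E(1)] by blast
      ultimately have "P (u # xs)" using xs u \<open>u \<noteq> x\<close> by (auto simp: P_def xys)
      then show False using max by fastforce
    qed
  qed
  \<comment> \<open>Of two neighbours on the path, one is not the second vertex. The cycle through
    it has length at least 3 and is not just an arc with its reversal.\<close>
  have "\<not> ?N \<subseteq> {hd ys}" using deg[of x] xs card_mono[of "{hd ys}" ?N] by (auto simp: P_def xys)
  then obtain u where u: "u \<in> ?N" "u \<noteq> hd ys" by blast
  then obtain as bs where ys: "ys = as @ u # bs" using N by (meson in_mono split_list)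
  have "as \<noteq> []" using u(2) ys by auto
  let ?c = "x # as @ [u]"
  let ?p = "(u, x) # vwalk_arcs ?c"
  have sub: "set (vwalk_arcs ?c) \<subseteq> parcs T"
    using xs vwalk_arcs_append_subset[of ?c bs] by (auto simp: P_def xys ys)
  have "(u, x) \<in> parcs T" using u(1) symD[OF E(1)] by blast
  then have "set ?p \<subseteq> parcs T" using sub by simp
  moreover have "u \<in> pverts T" using u(1) X(1) by blast
  moreover have "pcas u ?p u" using pcas_vwalk_arcs[of x "as @ [u]"] by simp
  ultimately have "awalk u ?p u" unfolding awalk_def by blast
  moreover have "pawalk_verts u ?p = u # ?c"
    using pawalk_verts_vwalk_arcs[of x "as @ [u]"] by simp
  moreover have "distinct ?c" using xs by (auto simp: P_def xys ys)
  ultimately have "cycle ?p" unfolding cycle_def by (intro exI[of _ u]) simp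
  moreover have "length (vwalk_arcs ?c) = Suc (length as)"
    unfolding vwalk_length_def[symmetric] by simp
  then have "3 \<le> length ?p" using \<open>as \<noteq> []\<close> by (cases as) auto
  ultimately show False using acyclic by blast
qed

lemma leaf_neighbour:
  assumes "v \<in> leaves T"
  obtains w where "\<And>u. (v, u) \<in> parcs T \<longleftrightarrow> u = w"
proof -
  have "card {e \<in> parcs T. fst e = v} = 1"
    using assms by (simp add: leaves_def out_degree_def out_arcs_def)
  then obtain e where e: "{e \<in> parcs T. fst e = v} = {e}" by (auto simp: card_1_singleton_iff)
  have "(v, u) \<in> parcs T \<longleftrightarrow> u = snd e" for u
  proof -
    have "e \<in> {e}" by simp
    then have "fst e = v" unfolding e[symmetric] by simp
    have "(v, u) \<in> parcs T \<longleftrightarrow> (v, u) \<in> {e \<in> parcs T. fst e = v}" by simp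
    also have "\<dots> \<longleftrightarrow> (v, u) = e" unfolding e by simp
    also have "\<dots> \<longleftrightarrow> u = snd e" using \<open>fst e = v\<close> by (cases e) simp
    finally show ?thesis .
  qed
  then show thesis by (rule that)
qed

text \<open>Two adjacent leaves have no further neighbours, so no walk leaves them. By connectedness
  they would be all of \<open>T\<close>, which would then be a complete graph on two
  vertices.\<close>

lemma leaves_not_adjacent:
  assumes T: "undirected_tree T" "\<not> K\<^bsub>2\<^esub> (with_proj T)" and uv: "u \<in> leaves T" "v \<in> leaves T"
  shows "(u, v) \<notin> parcs T"
proof
  assume arc: "(u, v) \<in> parcs T"
  have PT: "pair_graph T" using T(1) by (simp add: undirected_tree_def)
  interpret pair_graph T by (rule PT)
  note E = pair_graph_sym_irrefl[OF PT]
  have arc': "(v, u) \<in> parcs T" using arc symD[OF E(1)] by blast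
  have u: "(u, x) \<in> parcs T \<longleftrightarrow> x = v" for x using leaf_neighbour[OF uv(1)] arc by metis
  have v: "(v, x) \<in> parcs T \<longleftrightarrow> x = u" for x using leaf_neighbour[OF uv(2)] arc' by metis
  have "u \<noteq> v" using arc E(2) by (auto simp: irrefl_def)
  have sym: "parcs (mk_symmetric (with_proj T)) = parcs T"
    using symD[OF E(1)] by (auto simp: mk_symmetric_def)
  have "x \<in> {u, v}" if "x \<in> pverts T" for x
  proof -
    have "strongly_connected (with_proj (mk_symmetric (with_proj T)))"
      using T(1) by (simp add: undirected_tree_def connected_def)
    then have "u \<rightarrow>\<^sup>*\<^bsub>with_proj (mk_symmetric (with_proj T))\<^esub> x"
      using that in_arcsD1[OF arc] unfolding strongly_connected_def by (auto simp: mk_symmetric_def)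
    then have "(u, x) \<in> rtrancl_on (pverts T) (parcs T)"
      unfolding reachable_def using sym by (simp add: mk_symmetric_def)
    then show ?thesis
      by (induction rule: rtrancl_on_induct) (use u v in auto)
  qed
  then have V: "pverts T = {u, v}" using in_arcsD1[OF arc] in_arcsD1[OF arc'] by blast
  moreover have "parcs T = {(a, b). (a, b) \<in> pverts T \<times> pverts T \<and> a \<noteq> b}"
  proof (intro equalityI subrelI)
    fix a b assume "(a, b) \<in> parcs T"
    then show "(a, b) \<in> {(a, b). (a, b) \<in> pverts T \<times> pverts T \<and> a \<noteq> b}"
      using in_arcsD1 in_arcsD2 E(2) by (auto simp: irrefl_def)
  next
    fix a b assume "(a, b) \<in> {(a, b). (a, b) \<in> pverts T \<times> pverts T \<and> a \<noteq> b}"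
    then show "(a, b) \<in> parcs T" using V arc arc' by auto
  qed
  ultimately have "K\<^bsub>2\<^esub> (with_proj T)"
    using \<open>u \<noteq> v\<close> by (simp add: complete_digraph_pair_def)
  then show False using T(2) by blast
qed

text \<open>Every leaf is a class of its own and all other vertices are shared; this is a labelling
  because leaves are pairwise nonadjacent.\<close>

lemma leaf_labelling:
  assumes T: "undirected_tree T" "\<not> K\<^bsub>2\<^esub> (with_proj T)"
  obtains \<kappa> where "labelling (card (leaves T)) (pverts T) (parcs T) \<kappa>"
    "\<And>v. \<kappa> v \<noteq> 0 \<longleftrightarrow> v \<in> leaves T"
proof -
  interpret pair_graph T using T(1) by (simp add: undirected_tree_def)
  have "finite (leaves T)" using pair_finite_verts by (simp add: leaves_def)
  then obtain b where b: "bij_betw b (leaves T) {0..<card (leaves T)}"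
    using ex_bij_betw_finite_nat by blast
  define \<kappa> where "\<kappa> v = (if v \<in> leaves T then Suc (b v) else 0)" for v
  have "labelling (card (leaves T)) (pverts T) (parcs T) \<kappa>"
  proof (rule labellingI)
    show "\<kappa> v \<le> card (leaves T)" for v
      using bij_betwE[OF b] by (auto simp: \<kappa>_def)
    show "{1..card (leaves T)} \<subseteq> \<kappa> ` pverts T"
    proof
      fix i assume "i \<in> {1..card (leaves T)}"
      then have "i - 1 \<in> b ` leaves T" using b by (auto simp: bij_betw_def)
      then obtain v where "v \<in> leaves T" "b v = i - 1" by auto
      then have "v \<in> pverts T" "\<kappa> v = i"
        using \<open>i \<in> {1..card (leaves T)}\<close> by (auto simp: \<kappa>_def leaves_def)
      then show "i \<in> \<kappa> ` pverts T" by blast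
    qed
    show "\<kappa> u = \<kappa> v \<or> \<kappa> u = 0 \<or> \<kappa> v = 0" if "(u, v) \<in> parcs T" for u v
      using leaves_not_adjacent[OF T, of u v] that by (auto simp: \<kappa>_def)
  qed
  then show thesis using that[of \<kappa>] by (simp add: \<kappa>_def)
qed

text \<open>A copy of a leaf has only the shared vertex \<open>(w, 0)\<close> as a possible
  neighbour. If \<open>X\<close> contains no such copy, it consists of shared vertices and is a copy
  of a vertex set of \<open>T\<close>.\<close>

lemma one_degenerate_leaf_blow_up:
  assumes T: "one_degenerate (pverts T) (parcs T)" "finite (pverts T)"
    and \<kappa>: "\<And>v. \<kappa> v \<noteq> 0 \<longleftrightarrow> v \<in> leaves T"
    and indep: "\<And>u v. u \<in> leaves T \<Longrightarrow> v \<in> leaves T \<Longrightarrow> (u, v) \<notin> parcs T"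
  shows "one_degenerate (blow_verts (pverts T) \<kappa> m) (blow_arcs (parcs T) \<kappa>)"
  unfolding one_degenerate_def
proof (intro allI impI)
  fix X assume X: "X \<subseteq> blow_verts (pverts T) \<kappa> m" "X \<noteq> {}"
  let ?N = "\<lambda>x. {y \<in> X. (x, y) \<in> blow_arcs (parcs T) \<kappa>}"
  have zero: "j = 0" if "(v, j) \<in> X" "\<kappa> v = 0" for v j
    using X(1) that by (auto simp: blow_verts_def)
  show "\<exists>x\<in>X. card (?N x) \<le> 1"
  proof (cases "\<exists>x\<in>X. \<kappa> (fst x) \<noteq> 0")
    case True
    then obtain x where x: "x \<in> X" "fst x \<in> leaves T" using \<kappa> by blast
    obtain w where w: "\<And>u. (fst x, u) \<in> parcs T \<longleftrightarrow> u = w" using leaf_neighbour[OF x(2)] by blast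
    have "\<kappa> w = 0" using indep[OF x(2)] w \<kappa> by blast
    then have "?N x \<subseteq> {(w, 0)}" using w zero by (auto simp: blow_arcs_def)
    then have "card (?N x) \<le> 1" using card_mono[of "{(w, 0)}"] by simp
    then show ?thesis using x(1) by blast
  next
    case False
    have eq: "x = (fst x, 0)" if "x \<in> X" for x
    proof -
      have "\<kappa> (fst x) = 0" using False that by blast
      then have "snd x = 0" using zero[of "fst x" "snd x"] that by simp
      then show ?thesis by (simp add: prod_eq_iff)
    qed
    have "fst ` X \<subseteq> pverts T" using X(1) by (auto simp: blow_verts_def)
    moreover have "fst ` X \<noteq> {}" using X(2) by simp
    ultimately obtain v where v: "v \<in> fst ` X" "card {u \<in> fst ` X. (v, u) \<in> parcs T} \<le> 1"
      using T(1)[unfolded one_degenerate_def, rule_format] by blast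
    have fin: "finite (fst ` X)"
      using \<open>fst ` X \<subseteq> pverts T\<close> T(2) by (rule finite_subset)
    obtain x where x: "x \<in> X" "v = fst x" using v(1) by blast
    have "?N x \<subseteq> (\<lambda>u. (u, 0)) ` {u \<in> fst ` X. (v, u) \<in> parcs T}"
    proof
      fix y assume y: "y \<in> ?N x"
      then have "(v, fst y) \<in> parcs T" using x(2) by (auto simp: blow_arcs_def)
      then show "y \<in> (\<lambda>u. (u, 0)) ` {u \<in> fst ` X. (v, u) \<in> parcs T}"
        using y eq[of y] by (intro image_eqI[of _ _ "fst y"]) auto
    qed
    then have "card (?N x) \<le> card ((\<lambda>u. (u, 0::nat)) ` {u \<in> fst ` X. (v, u) \<in> parcs T})"
      using fin by (intro card_mono) auto
    also have "\<dots> \<le> card {u \<in> fst ` X. (v, u) \<in> parcs T}" using fin by (intro card_image_le) auto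
    finally show ?thesis using v(2) x(1) by (meson order_trans)
  qed
qed

section \<open>Extremal hosts and the contradiction for non-integral exponents\<close>

lemma ex_num_attained:
  assumes "0 < ex_num n H \<F>"
  obtains G :: "nat pair_pre_digraph" where "pair_graph G" "card (pverts G) = n" "family_free \<F> G"
    "ex_num n H \<F> = card (copies H G)"
proof -
  have ne: "copy_counts n H \<F> \<noteq> {}" using assms unfolding ex_num_def by (auto split: if_splits)
  then have "ex_num n H \<F> \<in> copy_counts n H \<F>"
    using Max_in[OF finite_copy_counts ne] by (simp add: ex_num_def)
  then show thesis unfolding copy_counts_def using that by blast
qed

theorem theorem2p4:
  fixes T :: "'a pair_pre_digraph" and l :: nat and r :: real
  assumes "undirected_tree T"
    and "\<not> K\<^bsub>2\<^esub> (with_proj T)"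
    and "card (leaves T) = l"
    and "2 \<le> l"
    and "r \<in> \<rat>"
    and "r \<in> {0..real l} - \<int>"
  shows "\<not> realizable T r"
proof
  assume "realizable T r"
  then obtain \<F> :: "nat pair_pre_digraph set" where fin: "finite \<F>"
    and \<F>: "\<forall>F\<in>\<F>. pair_graph F"
    and theta: "(\<lambda>n. real (ex_num n T \<F>)) \<in> \<Theta>(\<lambda>n. real n powr r)"
    unfolding realizable_def by blast
  let ?V = "pverts T" and ?E = "parcs T"
  have T: "pair_graph T" and deg: "one_degenerate ?V ?E"
    using assms(1) one_degenerate_if_acyclic by (auto simp: undirected_tree_def)
  interpret T: pair_graph T by (rule T)
  note E = pair_graph_sym_irrefl[OF T]
  have "r \<noteq> real l" "r \<noteq> 0" using assms(6) by auto
  then have r: "0 < r" "r < real l" using assms(6) by auto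
  have "leaves T \<noteq> {}" using assms(3,4) by auto
  then have cardV: "0 < card ?V" using T.pair_finite_verts by (auto simp: leaves_def card_gt_0_iff)
  \<comment> \<open>A labelling with \<open>q > r\<close> classes whose blow-ups are all free yields
    too many copies for \<open>theta\<close>. It is used for the leaves as classes and again for
    \<open>Suc p\<close> classes.\<close>
  have contr: False if "labelling q ?V ?E \<kappa>" "r < real q"
    "\<And>F m. F \<in> \<F> \<Longrightarrow> \<not> embeds (pverts F) (parcs F) (blow_verts ?V \<kappa> m) (blow_arcs ?E \<kappa>)" for q \<kappa>
  proof (rule not_bigo_if_power_le[OF bigthetaD1[OF theta] cardV that(2)])
    have "0 < q" using r(1) that(2) by (cases q) auto
    show "m ^ q \<le> ex_num (card ?V * m) T \<F>" for m
      by (rule blow_up_le_ex_num[OF T that(1) \<open>0 < q\<close> \<F> that(3)])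
  qed
  obtain \<kappa>0 where \<kappa>0: "labelling l ?V ?E \<kappa>0" "\<And>v. \<kappa>0 v \<noteq> 0 \<longleftrightarrow> v \<in> leaves T"
    using leaf_labelling[OF assms(1,2)] assms(3) by blast
  obtain F m where F: "F \<in> \<F>" "embeds (pverts F) (parcs F) (blow_verts ?V \<kappa>0 m) (blow_arcs ?E \<kappa>0)"
    using contr[OF \<kappa>0(1) r(2)] by blast
  let ?B = "blow_verts ?V \<kappa>0 m"
  \<comment> \<open>A host with more arcs would contain the forest \<open>?B\<close>, and with it
    the forbidden graph \<open>F\<close>.\<close>
  have sparse: "card (parcs G) \<le> 2 * card ?B * card (pverts G)"
    if G: "pair_graph G" "family_free \<F> G" for G :: "nat pair_pre_digraph"
  proof (rule ccontr)
    interpret G: pair_graph G by (rule G(1))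
    assume "\<not> ?thesis"
    moreover have "parcs G \<inter> pverts G \<times> pverts G = parcs G" using G.in_arcsD1 G.in_arcsD2 by auto
    ultimately have "embeds ?B (blow_arcs ?E \<kappa>0) (pverts G) (parcs G)"
      using leaves_not_adjacent[OF assms(1,2)]
      by (intro forest_embeds_if_many_arcs one_degenerate_leaf_blow_up deg \<kappa>0(2) finite_blow_verts
          sym_blow_arcs irrefl_blow_arcs E pair_graph_sym_irrefl(1)[OF G(1)]
          T.pair_finite_verts G.pair_finite_verts) (auto simp: not_le)
    then show False using embeds_trans[OF F(2)] F(1) G(2) family_free_iff[OF \<F> G(1)] by blast
  qed
  \<comment> \<open>As \<open>r\<close> is not an integer, it lies strictly between \<open>p\<close>
    and \<open>Suc p\<close>: there are enough copies to force \<open>Suc p\<close> classes, and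
    that many classes give too many.\<close>
  define p where "p = nat \<lfloor>r\<rfloor>"
  have "real_of_int \<lfloor>r\<rfloor> \<noteq> r" using assms(6) by (metis DiffD2 Ints_of_int)
  then have p: "real p < r" "r < real (Suc p)" using r(1) unfolding p_def by linarith+
  \<comment> \<open>\<open>t\<close> bounds the order of every forbidden graph, so all of them
    transfer from blow-ups to the host; \<open>Suc\<close> keeps it positive.\<close>
  define t where "t = Suc (\<Sum>F\<in>\<F>. card (pverts F))"
  have "0 < t" by (simp add: t_def)
  have t: "card (pverts F) \<le> t" if "F \<in> \<F>" for F
    using member_le_sum[OF that, of "\<lambda>F. card (pverts F)"] fin by (auto simp: t_def)
  obtain C where C: "\<forall>G :: nat pair_pre_digraph. pair_graph G \<longrightarrow>
      card (parcs G) \<le> 2 * card ?B * card (pverts G) \<longrightarrow>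
      C * card (pverts G) ^ Suc p < card (pverts G) * card (embeddings T G) \<longrightarrow>
      (\<exists>\<kappa>. labelling (Suc p) ?V ?E \<kappa> \<and>
        (\<forall>(W :: nat set) D m. finite W \<longrightarrow> card W \<le> t \<longrightarrow>
          embeds W D (blow_verts ?V \<kappa> m) (blow_arcs ?E \<kappa>) \<longrightarrow>
          embeds W D (pverts G) (parcs G)))"
    using many_embeddings_imp_blow_up[OF T deg \<open>0 < t\<close>] by blast
  obtain n where n: "C * n ^ Suc p < n * ex_num n T \<F>"
    by (rule bigomega_imp_large[OF bigthetaD2[OF theta] p(1)])
  then have "0 < ex_num n T \<F>" by (intro gr0I) simp
  then obtain G :: "nat pair_pre_digraph" where G: "pair_graph G" "card (pverts G) = n"
    "family_free \<F> G" "ex_num n T \<F> = card (copies T G)"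
    by (rule ex_num_attained)
  have "n * ex_num n T \<F> \<le> n * card (embeddings T G)"
    unfolding G(4) using card_copies_le_card_embeddings[OF T G(1)] by (rule mult_le_mono2)
  then have "C * card (pverts G) ^ Suc p < card (pverts G) * card (embeddings T G)"
    unfolding G(2) using n by linarith
  then obtain \<kappa> where \<kappa>: "labelling (Suc p) ?V ?E \<kappa>"
    "\<And>(W :: nat set) D m. finite W \<Longrightarrow> card W \<le> t \<Longrightarrow>
      embeds W D (blow_verts ?V \<kappa> m) (blow_arcs ?E \<kappa>) \<Longrightarrow> embeds W D (pverts G) (parcs G)"
    using C[rule_format, OF G(1) sparse[OF G(1,3)]] by blast
  \<comment> \<open>A forbidden graph in a blow-up with labels \<open>\<kappa>\<close> would embed
    into the free host \<open>G\<close>. So these blow-ups are free, although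
    \<open>\<kappa>\<close> has \<open>Suc p > r\<close> classes.\<close>
  show False
  proof (rule contr[OF \<kappa>(1) p(2)])
    fix F' k assume F': "F' \<in> \<F>"
    then interpret F': pair_graph F' using \<F> by blast
    have "\<not> embeds (pverts F') (parcs F') (pverts G) (parcs G)"
      using F' G(3) family_free_iff[OF \<F> G(1)] by blast
    then show "\<not> embeds (pverts F') (parcs F') (blow_verts ?V \<kappa> k) (blow_arcs ?E \<kappa>)"
      using \<kappa>(2)[OF F'.pair_finite_verts t[OF F']] by blast
  qed
qed

end
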